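(* Let $\varphi\colon A^*\to A^*$ be a non-erasing substitution extending over the letter $a_1\in A$, and let $h\colon A\to B$ be a coding; put $W=h(\varphi^{\infty}(a_1))$. There is an algorithm which decides whether the set of distinct $\varphi$-bounded factors of $\varphi^{\infty}(a_1)$ is finite. Moreover, if this set is infinite, the algorithm decides whether $W$ is ultimately periodic; if it is finite, the algorithm outputs all of its elements.
   Context: A substitution is non-erasing if no letter is mapped to the empty word; a coding is a morphism mapping each letter to a single letter. $\varphi$ extends over $a_1$ if $\varphi(a_1)=a_1v$ with $\varphi^k(v)\neq\varepsilon$ for all $k$, and then $\varphi^{\infty}(a_1)=a_1v\varphi(v)\varphi^2(v)\cdots$. A finite word $w\in A^*$ is $\varphi$-bounded if the sequence $w,\varphi(w),\varphi^2(w),\dots$ is ultimately periodic (equivalently, the lengths $|\varphi^n(w)|$ stay bounded); otherwise $w$ is $\varphi$-growing. An infinite word is ultimately periodic if it is of the form $wuuu\cdots$ with $w$ finite and $u$ nonempty finite. *)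

theory Defs
  imports Main "HOL-Library.Nat_Bijection"
begin

datatype recf = Zero | Succ | Proj nat | Comp recf "recf list" | Prim recf recf | Mu recf

inductive eval :: "recf \<Rightarrow> nat list \<Rightarrow> nat \<Rightarrow> bool" where
  eval_Zero: "eval Zero xs 0"
| eval_Succ: "eval Succ (x # xs) (Suc x)"
| eval_Proj: "i < length xs \<Longrightarrow> eval (Proj i) xs (xs ! i)"
| eval_Comp: "list_all2 (\<lambda>g y. eval g xs y) gs ys \<Longrightarrow> eval f ys z \<Longrightarrow> eval (Comp f gs) xs z"
| eval_Prim0: "eval f xs y \<Longrightarrow> eval (Prim f g) (0 # xs) y"
| eval_PrimS: "eval (Prim f g) (n # xs) y \<Longrightarrow> eval g (n # y # xs) z \<Longrightarrow> eval (Prim f g) (Suc n # xs) z"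
| eval_Mu: "eval f (n # xs) 0 \<Longrightarrow> (\<forall>m<n. \<exists>y. eval f (m # xs) y \<and> y > 0) \<Longrightarrow> eval (Mu f) xs n"

definition computable :: "(nat \<Rightarrow> nat) \<Rightarrow> bool" where
  "computable F \<longleftrightarrow> (\<exists>r. \<forall>x. eval r [x] (F x))"

text \<open>A substitution on the alphabet A = {0..<length sigma} is given by the list sigma
  of images: phi(a) = sigma ! a.\<close>

definition subst :: "nat list list \<Rightarrow> nat list \<Rightarrow> nat list" where
  "subst sigma w = concat (map (\<lambda>a. sigma ! a) w)"

definition is_subst :: "nat list list \<Rightarrow> bool" where
  "is_subst sigma \<longleftrightarrow> (\<forall>w\<in>set sigma. set w \<subseteq> {..<length sigma})"

definition non_erasing :: "nat list list \<Rightarrow> bool" where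
  "non_erasing sigma \<longleftrightarrow> (\<forall>w\<in>set sigma. w \<noteq> [])"

definition extends_over :: "nat list list \<Rightarrow> nat \<Rightarrow> bool" where
  "extends_over sigma a1 \<longleftrightarrow> a1 < length sigma \<and>
     (\<exists>v. sigma ! a1 = a1 # v \<and> (\<forall>k. (subst sigma ^^ k) v \<noteq> []))"

text \<open>The infinite word phi^infinity(a1) = a1 v phi(v) phi^2(v) ..., i.e. the limit of the
  words phi^n(a1), each a prefix of the next.\<close>
definition fixpt :: "nat list list \<Rightarrow> nat \<Rightarrow> nat \<Rightarrow> nat" where
  "fixpt sigma a1 i =
     (subst sigma ^^ (LEAST n. i < length ((subst sigma ^^ n) [a1]))) [a1] ! i"

definition factors :: "(nat \<Rightarrow> 'b) \<Rightarrow> 'b list set" where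
  "factors x = {u. \<exists>i. u = map x [i..<i + length u]}"

definition bounded_word :: "nat list list \<Rightarrow> nat list \<Rightarrow> bool" where
  "bounded_word sigma w \<longleftrightarrow>
     (\<exists>N p. p > 0 \<and> (\<forall>n\<ge>N. (subst sigma ^^ (n + p)) w = (subst sigma ^^ n) w))"

definition bounded_factors :: "nat list list \<Rightarrow> nat \<Rightarrow> nat list set" where
  "bounded_factors sigma a1 = {u \<in> factors (fixpt sigma a1). bounded_word sigma u}"

definition ult_periodic :: "(nat \<Rightarrow> 'b) \<Rightarrow> bool" where
  "ult_periodic x \<longleftrightarrow> (\<exists>N p. p > 0 \<and> (\<forall>n\<ge>N. x (n + p) = x n))"

definition encode_input :: "nat list list \<Rightarrow> nat list \<Rightarrow> nat \<Rightarrow> nat" where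
  "encode_input sigma hs a1 =
     prod_encode (list_encode (map list_encode sigma), prod_encode (list_encode hs, a1))"

definition decode_words :: "nat \<Rightarrow> nat list set" where
  "decode_words n = set (map list_decode (list_decode n))"

end

theory Submission
  imports Defs "HOL-Library.More_List" "HOL-Library.Sublist"
begin

text \<open>
  Write \<open>x\<close> for the fixed point. All three functions read their answer off a certificate that is
  found by unbounded search, so it suffices that certificates are decidable, sound and always
  exist.

  If the set of bounded factors is infinite, then some letter \<open>c\<close> of \<open>x\<close> satisfies
  \<open>\<phi>\<^sup>k c = u c y\<close> or \<open>\<phi>\<^sup>k c = y c u\<close> with \<open>u\<close> bounded and nonempty: otherwise the bounded prefixes
  and suffixes of all \<open>\<phi>\<^sup>n c\<close> have bounded length, and hence so have the bounded factors. Replacing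
  \<open>k\<close> by a multiple, \<open>z = \<phi>\<^sup>k u\<close> is fixed by \<open>\<phi>\<^sup>k\<close>, and then all powers of \<open>z\<close> are factors of \<open>x\<close>.
  Consequently, if \<open>h x\<close> is ultimately periodic at all, then it has the ultimate period \<open>\<bar>z\<bar>\<close>, which
  is visible on the factors of length \<open>\<bar>z\<bar> + 1\<close> that recur in \<open>x\<close>. If the set is finite, then for
  some \<open>m\<close> every factor of length \<open>m\<close> is growing.

  Both conditions refer to the factors of a given length \<open>m\<close>. The set of those that start
  in \<open>x\<close> at a position in \<open>[\<bar>\<phi>\<^sup>n a\<^sub>1\<bar>, \<bar>\<phi>\<^sup>n\<^sup>+\<^sup>1 a\<^sub>1\<bar>)\<close> determines the corresponding set for \<open>n + 1\<close>, so
  two equal sets reveal them all.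
\<close>

section \<open>Computable functions on encodable data\<close>

lemma eval_Comp1: "eval g xs y \<Longrightarrow> eval f [y] z \<Longrightarrow> eval (Comp f [g]) xs z"
  by (rule eval_Comp[where ys = "[y]"]) auto

lemma eval_Comp2:
  "eval g xs y \<Longrightarrow> eval g' xs y' \<Longrightarrow> eval f [y, y'] z \<Longrightarrow> eval (Comp f [g, g']) xs z"
  by (rule eval_Comp[where ys = "[y, y']"]) auto

lemma eval_Proj_0: "eval (Proj 0) (x # xs) x"
  using eval_Proj[of 0 "x # xs"] by simp

lemma eval_Proj_1: "eval (Proj 1) (x # y # xs) y"
  using eval_Proj[of 1 "x # y # xs"] by simp

text \<open>Primitive recursion whose step drops the counter is plain iteration. It underlies
  \<open>computable_funpow\<close> and so the loops of all later programs.\<close>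

lemma eval_Prim_funpow:
  assumes r: "\<And>y. eval r [y] (S y)"
  shows "eval (Prim (Proj 0) (Comp r [Proj 1])) [n, c] ((S ^^ n) c)"
proof (induction n)
  case 0
  show ?case
    by (simp add: eval_Prim0 eval_Proj_0)
next
  case (Suc n)
  have "eval (Comp r [Proj 1]) (n # (S ^^ n) c # [c]) (S ((S ^^ n) c))"
    by (rule eval_Comp1[OF eval_Proj_1 r])
  then show ?case
    using eval_PrimS[OF Suc] by simp
qed

section \<open>Recursive programs for arithmetic and the pairing function\<close>

definition recf_add :: recf where
  "recf_add = Prim (Proj 0) (Comp Succ [Proj 1])"

text \<open>The recursion step returns the counter and forgets the previous value, which is the
  predecessor.\<close>

definition recf_pred :: recf where
  "recf_pred = Prim Zero (Proj 0)"

text \<open>The recursion runs on the first argument, so the subtrahend comes first.\<close>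

definition recf_sub :: recf where
  "recf_sub = Prim (Proj 0) (Comp recf_pred [Proj 1])"

definition recf_triangle :: recf where
  "recf_triangle = Prim Zero (Comp recf_add [Comp Succ [Proj 0], Proj 1])"

definition recf_pair :: recf where
  "recf_pair = Comp recf_add [Comp recf_triangle [recf_add], Proj 0]"

lemma eval_recf_add: "eval recf_add [m, n] (m + n)"
proof -
  have "(Suc ^^ m) n = m + n"
    by (induction m) auto
  then show ?thesis
    using eval_Prim_funpow[of Succ Suc m n] unfolding recf_add_def by (simp add: eval_Succ)
qed

lemma eval_recf_pred: "eval recf_pred [n] (n - 1)"
proof (induction n)
  case 0
  show ?case
    by (simp add: recf_pred_def eval_Prim0 eval_Zero)
next
  case (Suc n)
  then show ?case
    unfolding recf_pred_def using eval_PrimS[of _ _ n "[]"] eval_Proj_0 by fastforce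
qed

lemma eval_recf_sub: "eval recf_sub [m, n] (n - m)"
proof -
  have "((\<lambda>k. k - 1) ^^ m) n = n - m"
    by (induction m) auto
  then show ?thesis
    using eval_Prim_funpow[OF eval_recf_pred, of m n] unfolding recf_sub_def by simp
qed

lemma eval_recf_triangle: "eval recf_triangle [n] (triangle n)"
proof (induction n)
  case 0
  show ?case
    by (simp add: recf_triangle_def eval_Prim0 eval_Zero)
next
  case (Suc n)
  have "eval (Comp recf_add [Comp Succ [Proj 0], Proj 1]) [n, triangle n] (Suc n + triangle n)"
    by (rule eval_Comp2[OF eval_Comp1[OF eval_Proj_0 eval_Succ] eval_Proj_1 eval_recf_add])
  then show ?case
    using eval_PrimS[of _ _ n "[]"] Suc unfolding recf_triangle_def by (fastforce simp: add.commute)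
qed

lemma eval_recf_pair: "eval recf_pair [m, n] (prod_encode (m, n))"
  unfolding recf_pair_def prod_encode_def
  using eval_Comp2[OF eval_Comp1[OF eval_recf_add eval_recf_triangle] eval_Proj_0 eval_recf_add]
  by simp

lemma computable_id: "computable (\<lambda>n. n)"
  unfolding computable_def using eval_Proj_0 by blast

lemma computable_compose:
  assumes "computable F" "computable G"
  shows "computable (\<lambda>n. F (G n))"
  using assms unfolding computable_def by (meson eval_Comp1)

lemma computable_binary:
  assumes "\<And>m n. eval r [m, n] (F m n)" "computable G" "computable H"
  shows "computable (\<lambda>n. F (G n) (H n))"
  using assms unfolding computable_def by (meson eval_Comp2)

lemmas computable_pair = computable_binary[OF eval_recf_pair]

lemma computable_Suc: "computable Suc"
  unfolding computable_def using eval_Succ by blast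

lemma computable_pred: "computable (\<lambda>n. n - 1)"
  unfolding computable_def using eval_recf_pred by blast

lemma computable_const: "computable (\<lambda>_. c)"
proof (induction c)
  case 0
  show ?case
    unfolding computable_def using eval_Zero by blast
next
  case (Suc c)
  show ?case
    by (rule computable_compose[OF computable_Suc Suc])
qed

text \<open>The unbounded search terminates because every argument is assumed to have a
  solution.\<close>

lemma computable_LeastI:
  assumes "computable F" "\<And>x. \<exists>n. F (prod_encode (x, n)) = 0"
  shows "computable (\<lambda>x. LEAST n. F (prod_encode (x, n)) = 0)"
proof -
  obtain r where r: "\<And>x. eval r [x] (F x)"
    using assms(1) unfolding computable_def by blast
  \<comment> \<open>\<open>Mu\<close> puts the searched number in front of the argument, while
    \<open>F\<close> expects the argument first in the pair.\<close>
  define s where "s = Comp r [Comp recf_pair [Proj 1, Proj 0]]"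
  have s: "eval s [n, x] (F (prod_encode (x, n)))" for n x
    unfolding s_def by (rule eval_Comp1[OF eval_Comp2[OF eval_Proj_1 eval_Proj_0 eval_recf_pair] r])
  have "eval (Mu s) [x] (LEAST n. F (prod_encode (x, n)) = 0)" (is "eval _ _ ?n") for x
  proof (rule eval_Mu)
    show "eval s [?n, x] 0"
      using s[of ?n x] LeastI_ex[OF assms(2), of x] by simp
    show "\<forall>m<?n. \<exists>y. eval s [m, x] y \<and> y > 0"
      using s not_less_Least by blast
  qed
  then show ?thesis
    unfolding computable_def by blast
qed

lemma computable_prod_decode:
  shows computable_fst: "computable (\<lambda>n. fst (prod_decode n))"
    and computable_snd: "computable (\<lambda>n. snd (prod_decode n))"
proof -
  text \<open>The number \<open>n\<close> encodes \<open>(a, b)\<close> where \<open>a + b\<close> is the least \<open>s\<close> with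
    \<open>n < triangle (Suc s)\<close>.\<close>
  define B where "B n = (LEAST s. Suc n - triangle (Suc s) = 0)" for n
  have F: "fst (prod_decode n) = n - triangle (B n)"
    and S: "snd (prod_decode n) = B n - (n - triangle (B n))" for n
  proof -
    obtain a b where ab: "prod_decode n = (a, b)"
      by fastforce
    have "prod_encode (prod_decode n) = n"
      by simp
    then have n: "n = triangle (a + b) + a"
      unfolding ab prod_encode_def by simp
    have mono: "triangle i \<le> triangle j" if "i \<le> j" for i j
      using that by (induction rule: dec_induct) auto
    have "B n = a + b"
      unfolding B_def
    proof (rule Least_equality)
      show "Suc n - triangle (Suc (a + b)) = 0"
        using n by simp
      show "a + b \<le> s" if "Suc n - triangle (Suc s) = 0" for s
      proof (rule ccontr)
        assume "\<not> a + b \<le> s"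
        then have "triangle (Suc s) \<le> triangle (a + b)"
          by (intro mono) simp
        then show False
          using n that by simp
      qed
    qed
    then show "fst (prod_decode n) = n - triangle (B n)"
      "snd (prod_decode n) = B n - (n - triangle (B n))"
      using n ab by auto
  qed
  have sub: "eval (Comp recf_sub [Proj 1, Proj 0]) [m, n] (m - n)" for m n
    by (rule eval_Comp2[OF eval_Proj_1 eval_Proj_0 eval_recf_sub])
  have tri: "computable triangle"
    unfolding computable_def using eval_recf_triangle by blast
  have B: "computable B"
  proof -
    let ?r = "Comp (Comp recf_sub [Proj 1, Proj 0])
      [Comp Succ [Proj 1], Comp recf_triangle [Comp Succ [Proj 0]]]"
    have r: "eval ?r [s, n] (Suc n - triangle (Suc s))" for s n
      by (rule eval_Comp2[OF eval_Comp1[OF eval_Proj_1 eval_Succ]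
            eval_Comp1[OF eval_Comp1[OF eval_Proj_0 eval_Succ] eval_recf_triangle] sub])
    have "eval (Mu ?r) [n] (B n)" for n
    proof (rule eval_Mu)
      \<comment> \<open>The search for \<open>B n\<close> terminates, since \<open>s = n\<close> is
        already large enough.\<close>
      have "Suc n - triangle (Suc n) = 0"
        by simp
      then have "Suc n - triangle (Suc (B n)) = 0"
        unfolding B_def by (rule LeastI)
      then show "eval ?r [B n, n] 0"
        using r[of "B n" n] by simp
      have "0 < Suc n - triangle (Suc m)" if "m < B n" for m
        using not_less_Least[OF that[unfolded B_def]] by blast
      then show "\<forall>m<B n. \<exists>y. eval ?r [m, n] y \<and> y > 0"
        using r by blast
    qed
    then show ?thesis
      unfolding computable_def by blast
  qed
  show f: "computable (\<lambda>n. fst (prod_decode n))"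
    unfolding F by (intro computable_binary[OF sub] computable_id computable_compose[OF tri] B)
  show "computable (\<lambda>n. snd (prod_decode n))"
    unfolding S F[symmetric] by (intro computable_binary[OF sub] B f)
qed

lemma computable_funpow:
  assumes "computable S" "computable F" "computable G"
  shows "computable (\<lambda>n. (S ^^ F n) (G n))"
proof -
  obtain r where "\<And>x. eval r [x] (S x)"
    using assms(1) unfolding computable_def by blast
  from computable_binary[OF eval_Prim_funpow[OF this] assms(2,3)] show ?thesis .
qed

section \<open>Computability on types coded bijectively by numbers\<close>

class encodable =
  fixes enc :: "'a \<Rightarrow> nat"
  assumes bij_enc: "bij enc"

text \<open>As \<open>enc\<close> is onto, every number codes a value, so a search over the numbers
  is a search over the type and no invalid codes arise.\<close>

definition dec :: "nat \<Rightarrow> 'a::encodable" where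
  "dec = inv enc"

lemma dec_enc [simp]: "dec (enc x) = x"
  unfolding dec_def by (simp add: bij_enc bij_is_inj)

lemma enc_dec [simp]: "enc (dec n) = n"
  unfolding dec_def by (simp add: bij_enc bij_is_surj surj_f_inv_f)

lemma enc_eq_iff [simp]: "enc x = enc y \<longleftrightarrow> x = y"
  by (metis dec_enc)

instantiation nat :: encodable
begin

definition enc_nat :: "nat \<Rightarrow> nat" where
  [simp]: "enc_nat n = n"

instance
proof
  have "(enc :: nat \<Rightarrow> nat) = id"
    by auto
  then show "bij (enc :: nat \<Rightarrow> nat)"
    by simp
qed

end

instantiation prod :: (encodable, encodable) encodable
begin

definition enc_prod :: "'a \<times> 'b \<Rightarrow> nat" where
  "enc_prod p = prod_encode (enc (fst p), enc (snd p))"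

instance
proof
  show "bij (enc :: 'a \<times> 'b \<Rightarrow> nat)"
  proof (rule bijI)
    show "inj (enc :: 'a \<times> 'b \<Rightarrow> nat)"
      by (rule injI) (simp add: enc_prod_def prod_eq_iff)
    show "surj (enc :: 'a \<times> 'b \<Rightarrow> nat)"
    proof (rule surjI)
      show "enc ((dec (fst (prod_decode n)) :: 'a), (dec (snd (prod_decode n)) :: 'b)) = n" for n
        by (simp add: enc_prod_def)
    qed
  qed
qed

end

instantiation list :: (encodable) encodable
begin

definition enc_list :: "'a list \<Rightarrow> nat" where
  "enc_list xs = list_encode (map enc xs)"

instance
proof
  show "bij (enc :: 'a list \<Rightarrow> nat)"
  proof (rule bijI)
    show "inj (enc :: 'a list \<Rightarrow> nat)"
      by (rule injI) (auto simp: enc_list_def list_encode_eq intro: injI dest!: map_injective)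
    show "surj (enc :: 'a list \<Rightarrow> nat)"
    proof (rule surjI)
      show "enc (map (dec :: nat \<Rightarrow> 'a) (list_decode n)) = n" for n
        by (simp add: enc_list_def o_def)
    qed
  qed
qed

end

definition cf :: "('a::encodable \<Rightarrow> 'b::encodable) \<Rightarrow> bool" where
  "cf f \<longleftrightarrow> computable (\<lambda>n. enc (f (dec n)))"

definition decidable :: "('a::encodable \<Rightarrow> bool) \<Rightarrow> bool" where
  "decidable P \<longleftrightarrow> cf (\<lambda>x. if P x then 1 else 0 :: nat)"

named_theorems cf_intros

lemma cfI:
  assumes "computable F" "\<And>x. F (enc x) = enc (f x)"
  shows "cf f"
proof -
  have "F = (\<lambda>n. enc (f (dec n)))"
    using assms(2) by (metis enc_dec)
  then show ?thesis
    using assms(1) unfolding cf_def by simp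
qed

lemma cfE:
  assumes "cf f"
  obtains F where "computable F" "\<And>x. F (enc x) = enc (f x)"
  using assms unfolding cf_def by (metis dec_enc)

lemma cf_compose:
  assumes "cf f" "cf g"
  shows "cf (\<lambda>x. f (g x))"
  using computable_compose[OF assms[unfolded cf_def]] unfolding cf_def by simp

lemma cf_id [cf_intros]: "cf (\<lambda>x. x)"
  by (rule cfI[OF computable_id]) simp

lemma cf_const [cf_intros]: "cf (\<lambda>_. c)"
  by (rule cfI[OF computable_const]) simp

lemma cf_Pair [cf_intros]:
  assumes "cf f" "cf g"
  shows "cf (\<lambda>x. (f x, g x))"
  using computable_pair[OF assms[unfolded cf_def]] unfolding cf_def enc_prod_def by simp

lemma cf_fst [cf_intros]:
  assumes "cf f"
  shows "cf (\<lambda>x. fst (f x))"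
  by (rule cf_compose[OF cfI assms, OF computable_fst]) (simp add: enc_prod_def)

lemma cf_snd [cf_intros]:
  assumes "cf f"
  shows "cf (\<lambda>x. snd (f x))"
  by (rule cf_compose[OF cfI assms, OF computable_snd]) (simp add: enc_prod_def)

lemma cf_compose2:
  assumes "cf (\<lambda>p. h (fst p) (snd p))" "cf f" "cf g"
  shows "cf (\<lambda>x. h (f x) (g x))"
  using cf_compose[OF assms(1) cf_Pair[OF assms(2,3)]] by simp

lemma cf_case_prod [cf_intros]:
  assumes "cf (\<lambda>p. f (fst p) (fst (snd p)) (snd (snd p)))" "cf g"
  shows "cf (\<lambda>x. case g x of (a, b) \<Rightarrow> f x a b)"
  using cf_compose2[of "\<lambda>x q. f x (fst q) (snd q)", OF assms(1) cf_id assms(2)]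
  by (simp add: case_prod_beta)

lemma cf_enc [cf_intros]: "cf f \<Longrightarrow> cf (\<lambda>x. enc (f x))"
  by (rule cf_compose[OF cfI, OF computable_id]) auto

text \<open>The loop construct to which conditionals, arithmetic and folds are reduced.\<close>

lemma cf_funpow [cf_intros]:
  fixes h :: "'a::encodable \<Rightarrow> 'b::encodable \<Rightarrow> 'b"
  assumes "cf (\<lambda>p. h (fst p) (snd p))" "cf n" "cf s"
  shows "cf (\<lambda>x. (h x ^^ n x) (s x))"
proof -
  obtain H where H: "computable H" "\<And>p. H (enc p) = enc (h (fst p) (snd p))"
    using assms(1) by (elim cfE) blast
  obtain N where N: "computable N" "\<And>x. N (enc x) = enc (n x)"
    using assms(2) by (elim cfE) blast
  obtain S where S: "computable S" "\<And>x. S (enc x) = enc (s x)"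
    using assms(3) by (elim cfE) blast
  \<comment> \<open>The parameter \<open>x\<close> travels unchanged in the first component, because
    \<open>computable_funpow\<close> iterates a function without parameters.\<close>
  define T where "T m = prod_encode (fst (prod_decode m), H m)" for m
  have T: "(T ^^ k) (enc (x, y)) = enc (x, (h x ^^ k) y)" for k x y
    by (induction k) (simp_all add: T_def H(2), simp add: enc_prod_def)
  have "computable (\<lambda>m. snd (prod_decode ((T ^^ N m) (prod_encode (m, S m)))))"
  proof (intro computable_compose[OF computable_snd] computable_funpow computable_pair
      computable_id N S)
    show "computable T"
      unfolding T_def by (intro computable_pair computable_fst H)
  qed
  moreover have "snd (prod_decode ((T ^^ N (enc x)) (prod_encode (enc x, S (enc x)))))
      = enc ((h x ^^ n x) (s x))" for x
    using T[of "n x" x "s x"] by (simp add: N S enc_prod_def)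
  ultimately show ?thesis
    by (rule cfI)
qed

text \<open>Branching is a loop executed once or never: one round overwrites the value
  \<open>g x\<close> by \<open>f x\<close>.\<close>

lemma cf_If [cf_intros]:
  assumes "decidable P" "cf f" "cf g"
  shows "cf (\<lambda>x. if P x then f x else g x)"
proof -
  have "cf (\<lambda>x. snd (((\<lambda>q. (fst q, fst q)) ^^ (if P x then 1 else 0 :: nat)) (f x, g x)))"
    by (intro cf_intros assms assms(1)[unfolded decidable_def])
  moreover have "snd (((\<lambda>q. (fst q, fst q)) ^^ (if P x then 1 else 0 :: nat)) (f x, g x))
      = (if P x then f x else g x)" for x
    by simp
  ultimately show ?thesis
    by simp
qed

lemma decidable_not [cf_intros]:
  assumes "decidable P"
  shows "decidable (\<lambda>x. \<not> P x)"
proof -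
  have "cf (\<lambda>x. if P x then 0 else 1 :: nat)"
    by (intro cf_intros assms)
  moreover have "(\<lambda>x. if P x then 0 else 1 :: nat) = (\<lambda>x. if \<not> P x then 1 else 0)"
    by auto
  ultimately show ?thesis
    unfolding decidable_def by simp
qed

lemma decidable_conj [cf_intros]:
  assumes "decidable P" "decidable Q"
  shows "decidable (\<lambda>x. P x \<and> Q x)"
proof -
  have "cf (\<lambda>x. if P x then if Q x then 1 else 0 else 0 :: nat)"
    by (intro cf_intros assms)
  moreover have "(\<lambda>x. if P x then if Q x then 1 else 0 else 0 :: nat)
      = (\<lambda>x. if P x \<and> Q x then 1 else 0)"
    by auto
  ultimately show ?thesis
    unfolding decidable_def by simp
qed

lemma decidable_disj [cf_intros]:
  assumes "decidable P" "decidable Q"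
  shows "decidable (\<lambda>x. P x \<or> Q x)"
  using decidable_not[OF decidable_conj[OF assms[THEN decidable_not]]] by simp

lemma decidable_imp [cf_intros]:
  assumes "decidable P" "decidable Q"
  shows "decidable (\<lambda>x. P x \<longrightarrow> Q x)"
  unfolding imp_conv_disj by (intro cf_intros assms)

lemma decidable_compose: "decidable P \<Longrightarrow> cf f \<Longrightarrow> decidable (\<lambda>x. P (f x))"
  unfolding decidable_def by (rule cf_compose)

lemma decidable_compose2:
  assumes "decidable (\<lambda>p. R (fst p) (snd p))" "cf f" "cf g"
  shows "decidable (\<lambda>x. R (f x) (g x))"
  using decidable_compose[OF assms(1) cf_Pair[OF assms(2,3)]] by simp

lemma cf_pred: "cf f \<Longrightarrow> cf (\<lambda>x. f x - 1 :: nat)"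
  by (rule cf_compose[OF cfI, OF computable_pred]) simp_all

lemma cf_diff [cf_intros]:
  assumes "cf f" "cf g"
  shows "cf (\<lambda>x. f x - g x :: nat)"
proof -
  have "cf (\<lambda>x. ((\<lambda>k. k - 1) ^^ g x) (f x))"
    by (intro cf_intros cf_pred assms)
  moreover have "((\<lambda>k. k - 1 :: nat) ^^ m) n = n - m" for m n
    by (induction m) auto
  ultimately show ?thesis
    by simp
qed

lemma cf_Suc [cf_intros]: "cf f \<Longrightarrow> cf (\<lambda>x. Suc (f x))"
  by (rule cf_compose[OF cfI, OF computable_Suc]) simp_all

lemma cf_add [cf_intros]:
  assumes "cf f" "cf g"
  shows "cf (\<lambda>x. f x + g x :: nat)"
proof -
  have "cf (\<lambda>x. ((\<lambda>k. Suc k) ^^ f x) (g x))"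
    by (intro cf_intros assms)
  moreover have "(Suc ^^ m) n = m + n" for m n
    by (induction m) auto
  ultimately show ?thesis
    by simp
qed

lemma decidable_eq_0: "cf f \<Longrightarrow> decidable (\<lambda>x. f x = (0 :: nat))"
proof -
  assume f: "cf f"
  have "cf (\<lambda>x. (1 :: nat) - f x)"
    by (intro cf_intros f)
  moreover have "(\<lambda>x. (1 :: nat) - f x) = (\<lambda>x. if f x = 0 then 1 else 0)"
    by auto
  ultimately show ?thesis
    unfolding decidable_def by simp
qed

lemma decidable_le [cf_intros]:
  assumes "cf f" "cf g"
  shows "decidable (\<lambda>x. f x \<le> (g x :: nat))"
  using decidable_eq_0[OF cf_diff[OF assms]] by simp

lemma decidable_less [cf_intros]:
  assumes "cf f" "cf g"
  shows "decidable (\<lambda>x. f x < (g x :: nat))"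
  using decidable_not[OF decidable_le[OF assms(2,1)]] by (simp add: not_le)

lemma decidable_eq [cf_intros]:
  assumes "cf f" "cf g"
  shows "decidable (\<lambda>x. f x = g x)"
proof -
  have "decidable (\<lambda>x. enc (f x) \<le> enc (g x) \<and> enc (g x) \<le> enc (f x))"
    by (intro cf_intros assms)
  then show ?thesis
    by (simp add: eq_iff[symmetric])
qed

section \<open>Computable operations on lists\<close>

lemma cf_Cons [cf_intros]:
  assumes "cf f" "cf g"
  shows "cf (\<lambda>x. f x # g x)"
proof -
  obtain F where F: "computable F" "\<And>x. F (enc x) = enc (f x)"
    using assms(1) by (elim cfE) blast
  obtain G where G: "computable G" "\<And>x. G (enc x) = enc (g x)"
    using assms(2) by (elim cfE) blast
  have "computable (\<lambda>n. Suc (prod_encode (F n, G n)))"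
    by (intro computable_compose[OF computable_Suc] computable_pair F G)
  then show ?thesis
    by (rule cfI) (simp add: F G enc_list_def)
qed

text \<open>A computable variant of \<^const>\<open>hd\<close>, whose value on the empty list is left unspecified
  by the library.\<close>
definition head :: "'a::encodable list \<Rightarrow> 'a" where
  "head xs = dec (fst (prod_decode (enc xs - 1)))"

lemma head_Cons [simp]: "head (x # xs) = x"
  by (simp add: head_def enc_list_def)

lemma cf_head: "cf f \<Longrightarrow> cf (\<lambda>x. head (f x))"
  by (rule cf_compose[OF cfI, OF computable_compose[OF computable_fst computable_pred]])
    (auto simp: head_def)

lemma cf_tl [cf_intros]: "cf f \<Longrightarrow> cf (\<lambda>x. tl (f x))"
proof (erule cf_compose[rotated], rule cfI[OF computable_compose[OF computable_snd computable_pred]])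
  \<comment> \<open>The empty list has code 0, whose truncated predecessor is again 0; decoding it
    must give back the code of the empty list, as \<open>tl [] = []\<close>.\<close>
  have "prod_decode 0 = (0, 0)"
    by (simp add: prod_decode_def prod_decode_aux.simps)
  then show "snd (prod_decode (enc xs - 1)) = enc (tl xs)" for xs :: "'b list"
    by (cases xs) (auto simp: enc_list_def)
qed

text \<open>Supplies a computable number of rounds for \<open>cf_foldl\<close>, at a point where the
  length is not yet known to be computable.\<close>

lemma length_le_enc: "length xs \<le> enc xs"
proof (induction xs)
  case (Cons x xs)
  have "enc xs \<le> prod_encode (enc x, enc xs)"
    by (rule le_prod_encode_2)
  then show ?case
    using Cons by (simp add: enc_list_def)
qed simp

text \<open>A fold is an iteration on pairs of an accumulator and the remaining list. It rests once
  the list is empty, so any number of rounds from the length upwards gives the same result.\<close>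

lemma cf_foldl [cf_intros]:
  assumes "cf (\<lambda>p. h (fst p) (fst (snd p)) (snd (snd p)))" "cf s" "cf l"
  shows "cf (\<lambda>x. foldl (h x) (s x) (l x))"
proof -
  define step where "step x q = (if snd q = [] then q else (h x (fst q) (head (snd q)), tl (snd q)))"
    for x q
  have steps: "(step x ^^ n) (a, ys) = (foldl (h x) a ys, [])" if "length ys \<le> n" for x n a ys
    using that
  proof (induction n arbitrary: a ys)
    case (Suc n)
    then show ?case
      by (cases ys) (simp_all add: step_def funpow_Suc_right del: funpow.simps)
  qed simp
  have "cf (\<lambda>p :: 'a \<times> 'b \<times> 'c list. (fst p, fst (snd p), head (snd (snd p))))"
    by (intro cf_intros cf_head)
  from cf_compose[OF assms(1) this]
  have "cf (\<lambda>p. h (fst p) (fst (snd p)) (head (snd (snd p))))"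
    by simp
  then have "cf (\<lambda>x. fst ((step x ^^ enc (l x)) (s x, l x)))"
    unfolding step_def by (intro cf_intros assms)
  then show ?thesis
    by (simp add: steps length_le_enc)
qed

lemma cf_rev [cf_intros]:
  assumes "cf f"
  shows "cf (\<lambda>x. rev (f x))"
proof -
  have "cf (\<lambda>x. foldl (\<lambda>a y. y # a) [] (f x))"
    by (intro cf_intros assms)
  moreover have "foldl (\<lambda>a y. y # a) zs ys = rev ys @ zs" for ys zs :: "'b list"
    by (induction ys arbitrary: zs) auto
  ultimately show ?thesis
    by simp
qed

lemma cf_append [cf_intros]:
  assumes "cf f" "cf g"
  shows "cf (\<lambda>x. f x @ g x)"
proof -
  have "cf (\<lambda>x. foldl (\<lambda>a y. y # a) (g x) (rev (f x)))"
    by (intro cf_intros assms)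
  moreover have "foldl (\<lambda>a y. y # a) zs ys = rev ys @ zs" for ys zs :: "'b list"
    by (induction ys arbitrary: zs) auto
  ultimately show ?thesis
    by simp
qed

lemma cf_length [cf_intros]:
  assumes "cf f"
  shows "cf (\<lambda>x. length (f x))"
proof -
  have "cf (\<lambda>x. foldl (\<lambda>a y. Suc a) 0 (f x))"
    by (intro cf_intros assms)
  moreover have "foldl (\<lambda>a y. Suc a) n ys = n + length ys" for n and ys :: "'b list"
    by (induction ys arbitrary: n) auto
  ultimately show ?thesis
    by simp
qed

lemma cf_map [cf_intros]:
  assumes "cf (\<lambda>p. f (fst p) (snd p))" "cf l"
  shows "cf (\<lambda>x. map (f x) (l x))"
proof -
  have "cf (\<lambda>x. foldl (\<lambda>a y. a @ [f x y]) [] (l x))"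
    by (intro cf_intros assms(2) cf_compose2[OF assms(1)])
  moreover have "foldl (\<lambda>a y. a @ [g y]) zs ys = zs @ map g ys" for g :: "'b \<Rightarrow> 'c" and ys zs
    by (induction ys arbitrary: zs) auto
  ultimately show ?thesis
    by simp
qed

lemma cf_concat [cf_intros]:
  assumes "cf f"
  shows "cf (\<lambda>x. concat (f x))"
proof -
  have "cf (\<lambda>x. foldl (\<lambda>a y. a @ y) [] (f x))"
    by (intro cf_intros assms)
  moreover have "foldl (\<lambda>a y. a @ y) zs ys = zs @ concat ys" for ys :: "'b list list" and zs
    by (induction ys arbitrary: zs) auto
  ultimately show ?thesis
    by simp
qed

lemma cf_filter [cf_intros]:
  assumes "decidable (\<lambda>p. P (fst p) (snd p))" "cf l"
  shows "cf (\<lambda>x. filter (P x) (l x))"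
proof -
  have "cf (\<lambda>x. concat (map (\<lambda>y. if P x y then [y] else []) (l x)))"
    by (intro cf_intros assms)
  moreover have "concat (map (\<lambda>y. if Q y then [y] else []) ys) = filter Q ys"
    for Q :: "'b \<Rightarrow> bool" and ys
    by (induction ys) auto
  ultimately show ?thesis
    by simp
qed

lemma decidable_Ball [cf_intros]:
  assumes "decidable (\<lambda>p. P (fst p) (snd p))" "cf l"
  shows "decidable (\<lambda>x. \<forall>y\<in>set (l x). P x y)"
proof -
  have "decidable (\<lambda>x. filter (\<lambda>y. \<not> P x y) (l x) = [])"
    by (intro cf_intros assms)
  then show ?thesis
    by (simp add: filter_empty_conv)
qed

lemma decidable_Bex [cf_intros]:
  assumes "decidable (\<lambda>p. P (fst p) (snd p))" "cf l"
  shows "decidable (\<lambda>x. \<exists>y\<in>set (l x). P x y)"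
  using decidable_not[OF decidable_Ball[OF decidable_not[OF assms(1)] assms(2)]] by simp

lemma decidable_member [cf_intros]:
  assumes "cf f" "cf l"
  shows "decidable (\<lambda>x. f x \<in> set (l x))"
proof -
  have "decidable (\<lambda>x. \<exists>y\<in>set (l x). f x = y)"
    by (intro cf_intros assms cf_compose[OF assms(1)])
  then show ?thesis
    by (simp add: Bex_def)
qed

lemma decidable_subset [cf_intros]:
  assumes "cf f" "cf l"
  shows "decidable (\<lambda>x. set (f x) \<subseteq> set (l x))"
proof -
  have "decidable (\<lambda>x. \<forall>y\<in>set (f x). y \<in> set (l x))"
    by (intro cf_intros assms cf_compose[OF assms(2)])
  then show ?thesis
    by (simp add: subset_iff Ball_def)
qed

lemma cf_drop [cf_intros]:
  assumes "cf n" "cf f"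
  shows "cf (\<lambda>x. drop (n x) (f x))"
proof -
  have "cf (\<lambda>x. ((\<lambda>l. tl l) ^^ n x) (f x))"
    by (intro cf_intros assms)
  moreover have "(tl ^^ k) ys = drop k ys" for k and ys :: "'b list"
    by (induction k) (auto simp: drop_Suc tl_drop)
  ultimately show ?thesis
    by simp
qed

lemma cf_take [cf_intros]:
  assumes "cf n" "cf f"
  shows "cf (\<lambda>x. take (n x) (f x))"
proof -
  have "cf (\<lambda>x. rev (drop (length (f x) - n x) (rev (f x))))"
    by (intro cf_intros assms)
  moreover have "rev (drop (length ys - k) (rev ys)) = take k ys" for k and ys :: "'b list"
    by (cases "k \<le> length ys") (simp_all add: rev_drop)
  ultimately show ?thesis
    by simp
qed

lemma cf_nth_default [cf_intros]:
  assumes "cf d" "cf f" "cf n"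
  shows "cf (\<lambda>x. nth_default (d x) (f x) (n x))"
proof -
  have "cf (\<lambda>x. if n x < length (f x) then head (drop (n x) (f x)) else d x)"
    by (intro cf_intros cf_head assms)
  moreover have "(if k < length ys then head (drop k ys) else z) = nth_default z ys k" for k z and ys :: "'b list"
    by (simp add: nth_default_def Cons_nth_drop_Suc[symmetric])
  ultimately show ?thesis
    by simp
qed

lemma cf_upt [cf_intros]:
  assumes "cf f" "cf g"
  shows "cf (\<lambda>x. [f x..<g x])"
proof -
  have "cf (\<lambda>x. drop (f x) (((\<lambda>l. l @ [length l]) ^^ g x) []))"
    by (intro cf_intros assms)
  moreover have "((\<lambda>l. l @ [length l]) ^^ k) [] = [0..<k]" for k
    by (induction k) auto
  ultimately show ?thesis
    by simp
qed

text \<open>Unbounded search is total as soon as every input has a solution, so no bound on the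
  size of the certificates is ever needed.\<close>
lemma cf_search:
  assumes "decidable (\<lambda>p. R (fst p) (snd p))" "\<And>x. \<exists>y. R x y"
  obtains f where "cf f" "\<And>x. R x (f x)"
proof -
  have "decidable (\<lambda>p. \<not> R (fst p) (snd p))"
    by (intro cf_intros assms)
  then obtain F where F: "computable F" "\<And>p. F (enc p) = (if \<not> R (fst p) (snd p) then 1 else 0)"
    unfolding decidable_def by (elim cfE) auto
  have F_iff: "F (prod_encode (enc x, n)) = 0 \<longleftrightarrow> R x (dec n)" for x n
    using F(2)[of "(x, dec n)"] by (simp add: enc_prod_def)
  have ex: "\<exists>n. F (prod_encode (m, n)) = 0" for m
    using assms(2)[of "dec m"] F_iff[of "dec m"] by (metis dec_enc enc_dec)
  define G where "G m = (LEAST n. F (prod_encode (m, n)) = 0)" for m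
  have "cf (\<lambda>x. dec (G (enc x)))"
    by (rule cfI[OF computable_LeastI[OF F(1) ex]]) (simp add: G_def)
  moreover have "R x (dec (G (enc x)))" for x
    using LeastI_ex[OF ex] F_iff unfolding G_def by blast
  ultimately show thesis
    using that by blast
qed

section \<open>Iterates of a substitution\<close>

lemma finite_range_repeats:
  assumes "finite (range (f :: nat \<Rightarrow> 'a))"
  shows "\<exists>i j. i < j \<and> f i = f j"
proof (rule ccontr)
  assume none: "\<not> ?thesis"
  have "inj f"
  proof (rule injI)
    fix i j assume "f i = f j"
    then show "i = j"
      using none by (cases i j rule: linorder_cases) metis+
  qed
  then show False
    using finite_imageD[OF assms] infinite_UNIV_nat by blast
qed

text \<open>A discrete intermediate value property. It places a position of the infinite word
  between consecutive values of \<open>len\<close> or of \<open>b\<close>.\<close>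

lemma step_interval:
  assumes "a \<le> k" "f a \<le> (j :: nat)" "j < f k"
  shows "\<exists>i. a \<le> i \<and> i < k \<and> f i \<le> j \<and> j < f (Suc i)"
  using assms
proof (induction k rule: dec_induct)
  case (step k)
  show ?case
  proof (cases "j < f k")
    case True
    then show ?thesis
      using step.IH step.prems less_SucI by blast
  next
    case False
    then show ?thesis
      using step.hyps step.prems by (intro exI[of _ k]) simp
  qed
qed simp

definition iter :: "nat list list \<Rightarrow> nat \<Rightarrow> nat list \<Rightarrow> nat list" where
  "iter sigma n w = (subst sigma ^^ n) w"

lemma subst_append [simp]: "subst sigma (u @ v) = subst sigma u @ subst sigma v"
  by (simp add: subst_def)

lemma subst_Nil [simp]: "subst sigma [] = []"
  by (simp add: subst_def)

lemma subst_Cons: "subst sigma (a # w) = sigma ! a @ subst sigma w"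
  by (simp add: subst_def)

lemma iter_0 [simp]: "iter sigma 0 w = w"
  by (simp add: iter_def)

lemma iter_Suc: "iter sigma (Suc n) w = subst sigma (iter sigma n w)"
  by (simp add: iter_def)

lemma iter_iter: "iter sigma m (iter sigma n w) = iter sigma (m + n) w"
  by (simp add: iter_def funpow_add)

lemma iter_Suc': "iter sigma (Suc n) w = iter sigma n (subst sigma w)"
  using iter_iter[of sigma n 1 w] by (simp add: iter_Suc)

lemma iter_append [simp]: "iter sigma n (u @ v) = iter sigma n u @ iter sigma n v"
  by (induction n) (simp_all add: iter_Suc)

lemma iter_Nil [simp]: "iter sigma n [] = []"
  by (induction n) (simp_all add: iter_Suc)

lemma iter_Cons: "iter sigma n (a # w) = iter sigma n [a] @ iter sigma n w"
  using iter_append[of sigma n "[a]" w] by simp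

lemma iter_concat: "iter sigma n w = concat (map (\<lambda>a. iter sigma n [a]) w)"
  by (induction w) (simp, subst iter_Cons, simp)

text \<open>Stability passes to multiples of the exponent, which makes a common exponent for several
  words possible: after \<open>P\<close> steps the word is a fixed point of
  \<open>iter sigma P\<close>.\<close>

lemma iter_stable_mult:
  assumes "iter sigma P (iter sigma P w) = iter sigma P w" "m > 0"
  shows "iter sigma (P * m) (iter sigma (P * m) w) = iter sigma (P * m) w"
proof -
  have fixed: "iter sigma (P * t) (iter sigma P w) = iter sigma P w" for t
    by (induction t) (simp_all add: iter_iter[symmetric] assms(1))
  obtain k where "m = Suc k"
    using assms(2) gr0_implies_Suc by blast
  then have "iter sigma (P * m) w = iter sigma (P * k) (iter sigma P w)"
    by (simp add: iter_iter add.commute)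
  then have "iter sigma (P * m) w = iter sigma P w"
    by (simp only: fixed)
  then show ?thesis
    by (simp only: fixed)
qed

lemma iter_mono_prefix: "prefix u v \<Longrightarrow> prefix (iter sigma n u) (iter sigma n v)"
  by (auto simp: prefix_def)

lemma bounded_word_iff:
  "bounded_word sigma w \<longleftrightarrow> (\<exists>N p. p > 0 \<and> (\<forall>n\<ge>N. iter sigma (n + p) w = iter sigma n w))"
  by (simp add: bounded_word_def iter_def)

lemma stable_bounded:
  assumes "P > 0" "iter sigma P (iter sigma P w) = iter sigma P w"
  shows "bounded_word sigma w"
  unfolding bounded_word_iff
proof (intro exI[of _ P] conjI allI impI assms(1))
  fix n assume "P \<le> n"
  then have "iter sigma (n + P) w = iter sigma (n - P) (iter sigma P (iter sigma P w))"
    and "iter sigma n w = iter sigma (n - P) (iter sigma P w)"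
    by (simp_all add: iter_iter)
  then show "iter sigma (n + P) w = iter sigma n w"
    using assms(2) by simp
qed

text \<open>A multiple of the period that lies beyond the preperiod replaces both parameters of
  ultimate periodicity by one.\<close>

lemma bounded_stable:
  assumes "bounded_word sigma w"
  obtains P where "P > 0" "iter sigma P (iter sigma P w) = iter sigma P w"
proof -
  obtain N p where p: "p > 0" "\<And>n. n \<ge> N \<Longrightarrow> iter sigma (n + p) w = iter sigma n w"
    using assms unfolding bounded_word_iff by blast
  have per: "iter sigma (n + p * t) w = iter sigma n w" if "n \<ge> N" for n t
  proof (induction t)
    case (Suc t)
    then show ?case
      using p(2)[of "n + p * t"] that by (simp add: algebra_simps)
  qed simp
  have "N \<le> p * Suc N"
    using p(1) by (cases p) auto
  then have "iter sigma (p * Suc N) (iter sigma (p * Suc N) w) = iter sigma (p * Suc N) w"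
    unfolding iter_iter by (rule per)
  then show thesis
    using that[of "p * Suc N"] p(1) by simp
qed

text \<open>A finitely checkable condition that makes boundedness decidable. A letter of the second
  kind reproduces a letter of that kind and gains length in every round of
  \<open>iter sigma P\<close>, hence grows; so stability at \<open>P\<close> coincides with
  boundedness.\<close>

definition good_exponent :: "nat list list \<Rightarrow> nat \<Rightarrow> bool" where
  "good_exponent sigma P \<longleftrightarrow> P > 0 \<and>
    (\<forall>a<length sigma. iter sigma P (iter sigma P [a]) = iter sigma P [a] \<or>
      2 \<le> length (iter sigma P [a]) \<and>
      (\<exists>b\<in>set (iter sigma P [a]). iter sigma P (iter sigma P [b]) \<noteq> iter sigma P [b]))"

locale substitution =
  fixes sigma :: "nat list list"
  assumes is_subst: "is_subst sigma" and non_erasing: "non_erasing sigma"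
begin

abbreviation \<phi> :: "nat \<Rightarrow> nat list \<Rightarrow> nat list" where
  "\<phi> \<equiv> iter sigma"

abbreviation A :: "nat set" where
  "A \<equiv> {..<length sigma}"

abbreviation bdd :: "nat list \<Rightarrow> bool" where
  "bdd \<equiv> bounded_word sigma"

lemma set_subst: "set w \<subseteq> A \<Longrightarrow> set (subst sigma w) \<subseteq> A"
  using is_subst unfolding is_subst_def subst_def by fastforce

lemma set_iter: "set w \<subseteq> A \<Longrightarrow> set (\<phi> n w) \<subseteq> A"
  by (induction n) (simp_all add: iter_Suc set_subst)

lemma image_length_pos: "a < length sigma \<Longrightarrow> 0 < length (sigma ! a)"
  using non_erasing unfolding non_erasing_def by auto

lemma length_subst: "set w \<subseteq> A \<Longrightarrow> length w \<le> length (subst sigma w)"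
proof (induction w)
  case (Cons a w)
  then show ?case
    using image_length_pos[of a] by (simp add: subst_Cons del: length_greater_0_conv)
qed simp

lemma length_iter_mono:
  assumes "set w \<subseteq> A" "m \<le> n"
  shows "length (\<phi> m w) \<le> length (\<phi> n w)"
  using assms(2)
proof (induction rule: dec_induct)
  case (step n)
  then show ?case
    using length_subst[OF set_iter[OF assms(1)], of n] by (simp add: iter_Suc)
qed simp

lemma length_iter: "set w \<subseteq> A \<Longrightarrow> length w \<le> length (\<phi> n w)"
  using length_iter_mono[of w 0 n] by simp

lemma iter_eq_Nil: "set w \<subseteq> A \<Longrightarrow> \<phi> n w = [] \<longleftrightarrow> w = []"
  using length_iter[of w n] by auto

text \<open>Only finitely many words over the alphabet have bounded length, so two iterates
  coincide. Conversely, lengths never decrease because no letter is erased, and it suffices to bound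
  them along the multiples of a stable exponent.\<close>

lemma bounded_iff_length:
  assumes "set w \<subseteq> A"
  shows "bdd w \<longleftrightarrow> (\<exists>K. \<forall>n. length (\<phi> n w) \<le> K)"
proof
  assume "bdd w"
  then obtain P where P: "P > 0" "\<phi> P (\<phi> P w) = \<phi> P w"
    by (rule bounded_stable)
  have "\<phi> (P * t) (\<phi> P w) = \<phi> P w" for t
    by (induction t) (simp_all add: iter_iter[symmetric] P(2))
  moreover have "n \<le> P * n + P" for n
    using P(1) by (cases P) auto
  ultimately have "length (\<phi> n w) \<le> length (\<phi> P w)" for n
    using length_iter_mono[OF assms, of n "P * n + P"] by (metis iter_iter)
  then show "\<exists>K. \<forall>n. length (\<phi> n w) \<le> K"
    by blast
next
  assume "\<exists>K. \<forall>n. length (\<phi> n w) \<le> K"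
  then obtain K where "\<And>n. length (\<phi> n w) \<le> K"
    by blast
  then have "range (\<lambda>n. \<phi> n w) \<subseteq> {v. set v \<subseteq> A \<and> length v \<le> K}"
    using set_iter[OF assms] by auto
  then have "finite (range (\<lambda>n. \<phi> n w))"
    using finite_lists_length_le[of A K] finite_subset by blast
  then obtain i j where ij: "i < j" "\<phi> i w = \<phi> j w"
    using finite_range_repeats by blast
  have "\<phi> (n + (j - i)) w = \<phi> n w" if "n \<ge> i" for n
    using that ij iter_iter[of sigma "n - i" i w] iter_iter[of sigma "n - i" j w] by simp
  then show "bdd w"
    unfolding bounded_word_iff using ij(1) by (intro exI[of _ i] exI[of _ "j - i"]) simp
qed

lemma bounded_append:
  assumes "set u \<subseteq> A" "set v \<subseteq> A"
  shows "bdd (u @ v) \<longleftrightarrow> bdd u \<and> bdd v"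
proof -
  have uv: "set (u @ v) \<subseteq> A"
    using assms by simp
  show ?thesis
    unfolding bounded_iff_length[OF uv] bounded_iff_length[OF assms(1)]
      bounded_iff_length[OF assms(2)]
    by simp (meson add_leE add_mono)
qed

lemma bounded_Nil [simp]: "bdd []"
  by (simp add: bounded_iff_length)

lemma bounded_sublist:
  assumes "bdd w" "set w \<subseteq> A" "sublist u w"
  shows "bdd u"
proof -
  obtain p s where "w = p @ u @ s"
    using assms(3) unfolding sublist_def by blast
  then show ?thesis
    using assms(1,2) by (auto simp: bounded_append)
qed

lemma bounded_iff_letters: "set w \<subseteq> A \<Longrightarrow> bdd w \<longleftrightarrow> (\<forall>a\<in>set w. bdd [a])"
proof (induction w)
  case (Cons a w)
  then show ?case
    using bounded_append[of "[a]" w] by simp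
qed simp

lemma bounded_iter:
  assumes "set w \<subseteq> A"
  shows "bdd (\<phi> k w) \<longleftrightarrow> bdd w"
  unfolding bounded_iff_length[OF assms] bounded_iff_length[OF set_iter[OF assms]] iter_iter
  using length_iter_mono[OF assms] by (meson le_add1 order_trans)

text \<open>Multiply exponents of the finitely many bounded letters; words follow letter by
  letter.\<close>

lemma uniform_exponent:
  obtains P where "P > 0" "\<And>w. set w \<subseteq> A \<Longrightarrow> bdd w \<Longrightarrow> \<phi> P (\<phi> P w) = \<phi> P w"
proof -
  have "\<exists>P>0. \<forall>a<k. bdd [a] \<longrightarrow> \<phi> P (\<phi> P [a]) = \<phi> P [a]" for k
  proof (induction k)
    case (Suc k)
    then obtain P where P: "P > 0" "\<And>a. a < k \<Longrightarrow> bdd [a] \<Longrightarrow> \<phi> P (\<phi> P [a]) = \<phi> P [a]"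
      by blast
    obtain Q where Q: "Q > 0" "bdd [k] \<Longrightarrow> \<phi> Q (\<phi> Q [k]) = \<phi> Q [k]"
      using bounded_stable[of sigma "[k]"] by (metis zero_less_one)
    have "\<phi> (P * Q) (\<phi> (P * Q) [a]) = \<phi> (P * Q) [a]" if "a < Suc k" "bdd [a]" for a
    proof (cases "a = k")
      case True
      then show ?thesis
        using iter_stable_mult[OF Q(2) P(1)] that by (simp add: mult.commute)
    next
      case False
      then show ?thesis
        using iter_stable_mult[OF P(2) Q(1)] that by simp
    qed
    then show ?case
      using P(1) Q(1) by (intro exI[of _ "P * Q"]) simp
  qed auto
  then obtain P where P: "P > 0"
    "\<And>a. a < length sigma \<Longrightarrow> bdd [a] \<Longrightarrow> \<phi> P (\<phi> P [a]) = \<phi> P [a]"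
    by meson
  have "\<phi> P (\<phi> P w) = \<phi> P w" if "set w \<subseteq> A" "bdd w" for w
    using that
  proof (induction w)
    case (Cons a w)
    then have "bdd [a]" "bdd w"
      using bounded_append[of "[a]" w] by simp_all
    then show ?case
      using Cons P(2)[of a] by (simp add: iter_Cons[of sigma P a w])
  qed simp
  then show thesis
    using that P(1) by blast
qed

text \<open>A large multiple of the uniform exponent makes the image of every growing letter have
  length at least 2, and such an image always contains a growing letter, which is unstable.\<close>

lemma good_exponent_exists: "\<exists>P. good_exponent sigma P"
proof -
  obtain P where P: "P > 0" "\<And>w. set w \<subseteq> A \<Longrightarrow> bdd w \<Longrightarrow> \<phi> P (\<phi> P w) = \<phi> P w"
    using uniform_exponent by blast
  have "\<exists>T. \<forall>a<k. a < length sigma \<longrightarrow> \<not> bdd [a] \<longrightarrow> 2 \<le> length (\<phi> T [a])" for k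
  proof (induction k)
    case (Suc k)
    then obtain T where T: "\<And>a. a < k \<Longrightarrow> a < length sigma \<Longrightarrow> \<not> bdd [a] \<Longrightarrow> 2 \<le> length (\<phi> T [a])"
      by blast
    have "\<exists>t. \<not> length (\<phi> t [k]) \<le> 1" if "k < length sigma" "\<not> bdd [k]"
      using that bounded_iff_length[of "[k]"] by auto
    then have "\<exists>t. k < length sigma \<longrightarrow> \<not> bdd [k] \<longrightarrow> 2 \<le> length (\<phi> t [k])"
      by (metis Suc_1 not_less_eq_eq)
    then obtain t where t: "k < length sigma \<Longrightarrow> \<not> bdd [k] \<Longrightarrow> 2 \<le> length (\<phi> t [k])"
      by blast
    have "2 \<le> length (\<phi> (max T t) [a])" if "a < Suc k" "a < length sigma" "\<not> bdd [a]" for a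
    proof -
      have "2 \<le> length (\<phi> T [a]) \<or> 2 \<le> length (\<phi> t [a])"
        using that T t by (cases "a = k") auto
      then show ?thesis
        using length_iter_mono[of "[a]" T "max T t"] length_iter_mono[of "[a]" t "max T t"] that
        by auto
    qed
    then show ?case
      by blast
  qed simp
  then obtain T where T: "\<And>a. a < length sigma \<Longrightarrow> \<not> bdd [a] \<Longrightarrow> 2 \<le> length (\<phi> T [a])"
    by meson
  \<comment> \<open>\<open>Suc T\<close> keeps \<open>Q\<close> a positive multiple of
    \<open>P\<close> that is at least \<open>T\<close>.\<close>
  define Q where "Q = P * Suc T"
  have Q: "Q > 0" "T \<le> Q"
    using P(1) unfolding Q_def by (simp, cases P, auto)
  have stable: "\<phi> Q (\<phi> Q w) = \<phi> Q w \<longleftrightarrow> bdd w" if "set w \<subseteq> A" for w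
    using iter_stable_mult[OF P(2)[OF that], of "Suc T"] stable_bounded[OF Q(1)] unfolding Q_def by auto
  have "good_exponent sigma Q"
    unfolding good_exponent_def
  proof (intro conjI allI impI Q(1))
    fix a assume a: "a < length sigma"
    show "\<phi> Q (\<phi> Q [a]) = \<phi> Q [a] \<or> 2 \<le> length (\<phi> Q [a]) \<and>
      (\<exists>b\<in>set (\<phi> Q [a]). \<phi> Q (\<phi> Q [b]) \<noteq> \<phi> Q [b])"
    proof (cases "bdd [a]")
      case True
      then show ?thesis
        using stable[of "[a]"] a by simp
    next
      case False
      have len: "2 \<le> length (\<phi> Q [a])"
        using T[OF a False] length_iter_mono[of "[a]" T Q] Q(2) a by simp
      have sub: "set (\<phi> Q [a]) \<subseteq> A"
        using a by (intro set_iter) simp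
      have "\<not> bdd (\<phi> Q [a])"
        using False bounded_iter[of "[a]" Q] a by simp
      then obtain b where b: "b \<in> set (\<phi> Q [a])" "\<not> bdd [b]"
        using bounded_iff_letters[OF sub] by blast
      then have "\<phi> Q (\<phi> Q [b]) \<noteq> \<phi> Q [b]"
        using stable[of "[b]"] sub by auto
      then show ?thesis
        using len b(1) by blast
    qed
  qed
  then show ?thesis
    by blast
qed

text \<open>An unstable letter produces an unstable letter and at least one further letter, none of
  which ever shrinks. So its length exceeds \<open>j\<close> after \<open>j\<close> rounds, and no
  bounded letter can be unstable.\<close>

lemma good_exponent_bounded:
  assumes "good_exponent sigma P" "set w \<subseteq> A"
  shows "bdd w \<longleftrightarrow> \<phi> P (\<phi> P w) = \<phi> P w"
proof
  have P: "P > 0"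
    using assms(1) by (simp add: good_exponent_def)
  have grow: "Suc j \<le> length (\<phi> (P * j) [a])"
    if "a < length sigma" "\<phi> P (\<phi> P [a]) \<noteq> \<phi> P [a]" for a j
    using that
  proof (induction j arbitrary: a)
    case (Suc j)
    then obtain b where b: "2 \<le> length (\<phi> P [a])" "b \<in> set (\<phi> P [a])"
      "\<phi> P (\<phi> P [b]) \<noteq> \<phi> P [b]"
      using assms(1) unfolding good_exponent_def by blast
    obtain u v where uv: "\<phi> P [a] = u @ b # v"
      using split_list[OF b(2)] by blast
    have sub: "set (\<phi> P [a]) \<subseteq> A"
      using Suc.prems(1) by (intro set_iter) simp
    then have "length u \<le> length (\<phi> (P * j) u)" "length v \<le> length (\<phi> (P * j) v)"
      unfolding uv by (auto intro: length_iter)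
    moreover have "Suc j \<le> length (\<phi> (P * j) [b])"
      using b sub by (intro Suc.IH) auto
    moreover have "\<phi> (P * Suc j) [a] = \<phi> (P * j) u @ \<phi> (P * j) [b] @ \<phi> (P * j) v"
      using iter_iter[of sigma "P * j" P "[a]"] iter_Cons[of sigma "P * j" b v]
      by (simp add: uv add.commute)
    ultimately show ?case
      using b(1) unfolding uv by simp
  qed simp
  show "bdd w" if "\<phi> P (\<phi> P w) = \<phi> P w"
    using stable_bounded[OF P that] .
  have letter: "\<phi> P (\<phi> P [a]) = \<phi> P [a]" if "a < length sigma" "bdd [a]" for a
    using grow[OF that(1)] that bounded_iff_length[of "[a]"] by (auto simp: not_less_eq_eq[symmetric])
  assume "bdd w"
  then show "\<phi> P (\<phi> P w) = \<phi> P w"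
    using assms(2)
  proof (induction w)
    case (Cons a w)
    then have "bdd [a]" "bdd w"
      using bounded_append[of "[a]" w] by simp_all
    then show ?case
      using Cons letter[of a] by (simp add: iter_Cons[of sigma P a w])
  qed simp
qed

end

section \<open>The fixed point and its factors\<close>

locale prolongable = substitution +
  fixes a1 :: nat
  assumes extends: "extends_over sigma a1"
begin

abbreviation x :: "nat \<Rightarrow> nat" where
  "x \<equiv> fixpt sigma a1"

definition len :: "nat \<Rightarrow> nat" where
  "len n = length (\<phi> n [a1])"

lemma a1_letter: "a1 < length sigma"
  using extends by (simp add: extends_over_def)

lemma set_iter_a1: "set (\<phi> n [a1]) \<subseteq> A"
  using a1_letter by (intro set_iter) simp

lemma iter_Suc_a1: "\<exists>v. \<phi> (Suc n) [a1] = \<phi> n [a1] @ v \<and> v \<noteq> []"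
proof -
  obtain v where v: "sigma ! a1 = a1 # v" "\<And>k. \<phi> k v \<noteq> []"
    using extends unfolding extends_over_def iter_def by blast
  have "\<phi> (Suc n) [a1] = \<phi> n ([a1] @ v)"
    by (simp add: iter_Suc' subst_Cons v(1))
  then show ?thesis
    using v(2)[of n] by (simp only: iter_append) blast
qed

lemma len_strict_mono: "strict_mono len"
  unfolding strict_mono_Suc_iff
proof
  show "len n < len (Suc n)" for n
    using iter_Suc_a1[of n] by (auto simp: len_def)
qed

lemma len_less_iff [simp]: "len m < len n \<longleftrightarrow> m < n" and len_le_iff [simp]: "len m \<le> len n \<longleftrightarrow> m \<le> n"
  by (simp_all add: len_strict_mono strict_mono_less strict_mono_less_eq)

lemma less_len: "n < len n"
proof (induction n)
  case (Suc n)
  have "len n < len (Suc n)"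
    by simp
  then show ?case
    using Suc by linarith
qed (simp add: len_def)

lemma prefix_iter_a1: "m \<le> n \<Longrightarrow> prefix (\<phi> m [a1]) (\<phi> n [a1])"
proof (induction rule: dec_induct)
  case (step n)
  then show ?case
    using iter_Suc_a1[of n] by (metis prefixI prefix_order.trans)
qed simp

lemma x_nth:
  assumes "i < len n"
  shows "x i = \<phi> n [a1] ! i"
proof -
  define m where "m = (LEAST n. i < len n)"
  have "x i = \<phi> m [a1] ! i"
    unfolding fixpt_def m_def len_def iter_def by simp
  moreover have "i < len m" "m \<le> n"
    unfolding m_def using assms by (rule LeastI, rule Least_le)
  ultimately show ?thesis
    using prefix_iter_a1[of m n] by (auto simp: prefix_def nth_append len_def)
qed

lemma x_factor:
  assumes "j + m \<le> len n"
  shows "map x [j..<j + m] = take m (drop j (\<phi> n [a1]))"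
proof (rule nth_equalityI)
  show "length (map x [j..<j + m]) = length (take m (drop j (\<phi> n [a1])))"
    using assms by (simp add: len_def)
  show "map x [j..<j + m] ! i = take m (drop j (\<phi> n [a1])) ! i"
    if "i < length (map x [j..<j + m])" for i
    using that assms x_nth[of "j + i" n] by (simp add: len_def)
qed

lemma x_prefix: "m \<le> len n \<Longrightarrow> map x [0..<m] = take m (\<phi> n [a1])"
  using x_factor[of 0 m n] by simp

lemma x_letter: "x i < length sigma"
proof -
  have i: "i < len i"
    by (rule less_len)
  then have "x i \<in> set (\<phi> i [a1])"
    unfolding x_nth[OF i] by (simp add: len_def)
  then show ?thesis
    using set_iter_a1 by blast
qed

lemma set_factor: "set (map x [i..<j]) \<subseteq> A"
  using x_letter by auto

lemma factors_x_iff: "u \<in> factors x \<longleftrightarrow> (\<exists>n. sublist u (\<phi> n [a1]))"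
proof
  assume "u \<in> factors x"
  then obtain i where i: "u = map x [i..<i + length u]"
    unfolding factors_def by blast
  have "i + length u \<le> len (i + length u)"
    using less_len[of "i + length u"] by simp
  from x_factor[OF this] have "u = take (length u) (drop i (\<phi> (i + length u) [a1]))"
    using i by simp
  then show "\<exists>n. sublist u (\<phi> n [a1])"
    by (metis sublist_drop sublist_order.order.trans sublist_take)
next
  assume "\<exists>n. sublist u (\<phi> n [a1])"
  then obtain n p s where n: "\<phi> n [a1] = p @ u @ s"
    unfolding sublist_def by blast
  then have "length p + length u \<le> len n"
    by (simp add: len_def)
  from x_factor[OF this] show "u \<in> factors x"
    unfolding factors_def n by (intro CollectI exI[of _ "length p"]) simp
qed

lemma factorsI: "map x [j..<j + m] \<in> factors x"
  unfolding factors_def by (intro CollectI exI[of _ j]) simp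

text \<open>As \<open>x\<close> is fixed by the substitution, the letter \<open>x i\<close> produces the block of \<open>x\<close> that
  starts at position \<open>b i\<close>.\<close>
definition b :: "nat \<Rightarrow> nat" where
  "b i = length (subst sigma (map x [0..<i]))"

text \<open>The fixed point equation for \<open>x\<close>, in the form of an equation between
  prefixes.\<close>

lemma subst_x_prefix: "subst sigma (map x [0..<i]) = map x [0..<b i]"
proof -
  have "i \<le> len i"
    using less_len[of i] by simp
  then have i: "map x [0..<i] = take i (\<phi> i [a1])"
    by (rule x_prefix)
  have "subst sigma (take i (\<phi> i [a1]) @ drop i (\<phi> i [a1])) = \<phi> (Suc i) [a1]"
    by (simp add: iter_Suc)
  then have eq: "\<phi> (Suc i) [a1] = subst sigma (map x [0..<i]) @ subst sigma (drop i (\<phi> i [a1]))"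
    unfolding i subst_append by simp
  then have "b i \<le> len (Suc i)"
    unfolding b_def len_def by simp
  then have "map x [0..<b i] = take (b i) (\<phi> (Suc i) [a1])"
    by (rule x_prefix)
  then show ?thesis
    unfolding eq by (simp add: b_def)
qed

lemma map_upt_split: "i \<le> j \<Longrightarrow> map f [0..<j] = map f [0..<i] @ map f [i..<j]"
  using upt_add_eq_append[of 0 i "j - i"] by simp

lemma subst_x_factor:
  assumes "i \<le> j"
  shows "b i + (j - i) \<le> b j" and "subst sigma (map x [i..<j]) = map x [b i..<b j]"
proof -
  have eq: "subst sigma (map x [0..<j]) = subst sigma (map x [0..<i]) @ subst sigma (map x [i..<j])"
    unfolding map_upt_split[OF assms] by simp
  have "j - i \<le> length (subst sigma (map x [i..<j]))"
    using length_subst[OF set_factor, of i j] by simp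
  then show le: "b i + (j - i) \<le> b j"
    using eq unfolding b_def by simp
  then have "map x [0..<b j] = map x [0..<b i] @ map x [b i..<b j]"
    by (intro map_upt_split) simp
  then show "subst sigma (map x [i..<j]) = map x [b i..<b j]"
    using eq unfolding subst_x_prefix by simp
qed

lemma b_mono: "i \<le> j \<Longrightarrow> b i \<le> b j"
  using subst_x_factor(1)[of i j] by simp

lemma b_0 [simp]: "b 0 = 0"
  by (simp add: b_def)

lemma b_Suc: "b (Suc i) = b i + length (sigma ! x i)"
  by (simp add: b_def subst_Cons)

lemma b_len: "b (len n) = len (Suc n)"
  using x_prefix[of "len n" n] by (simp add: b_def len_def iter_Suc)

text \<open>Desubstitution of a position: the blocks of the single letters tile the infinite
  word.\<close>

lemma ancestor: "\<exists>i k. j = b i + k \<and> k < length (sigma ! x i)"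
proof -
  have "j < b (Suc j)"
    using subst_x_factor(1)[of 0 "Suc j"] by simp
  then obtain i where "b i \<le> j" "j < b (Suc i)"
    using step_interval[of 0 "Suc j" b j] by auto
  then show ?thesis
    by (intro exI[of _ i] exI[of _ "j - b i"]) (simp add: b_Suc)
qed

text \<open>The window of length \<open>m\<close> at \<open>i\<close> determines every window of
  length \<open>m\<close> that starts inside the block of \<open>x i\<close>. This makes the passage
  from one stage to the next deterministic.\<close>

lemma image_factor:
  assumes "m > 0" "k < length (sigma ! x i)"
  shows "map x [b i + k..<b i + k + m] = take m (drop k (subst sigma (map x [i..<i + m])))"
proof -
  \<comment> \<open>The \<open>m - 1\<close> blocks after the first are nonempty, so they contribute
    at least \<open>m - 1\<close> letters; the first block extends beyond offset
    \<open>k\<close>.\<close>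
  have "b (Suc i) + (i + m - Suc i) \<le> b (i + m)"
    using assms(1) by (intro subst_x_factor(1)) simp
  then have "b i + k + m \<le> b (i + m)"
    using assms by (simp add: b_Suc)
  then have "take m (drop k [b i..<b (i + m)]) = [b i + k..<b i + k + m]"
    by (simp add: drop_upt take_upt)
  then show ?thesis
    by (simp add: subst_x_factor(2) drop_map take_map)
qed

section \<open>Stages: the factors of length \<open>m\<close>, generation by generation\<close>

definition stage :: "nat \<Rightarrow> nat \<Rightarrow> nat list set" where
  "stage m n = (\<lambda>j. map x [j..<j + m]) ` {len n..<len (Suc n)}"

text \<open>Since \<open>b\<close> maps \<open>len n\<close> to \<open>len (Suc n)\<close>, each
  position of generation \<open>Suc n\<close> has its ancestor in generation \<open>n\<close>, and
  by \<open>image_factor\<close> only the window at the ancestor matters.\<close>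

lemma stage_Suc_mono:
  assumes "m > 0" "stage m n \<subseteq> stage m n'"
  shows "stage m (Suc n) \<subseteq> stage m (Suc n')"
proof
  fix w assume "w \<in> stage m (Suc n)"
  then obtain j where j: "len (Suc n) \<le> j" "j < len (Suc (Suc n))" "w = map x [j..<j + m]"
    unfolding stage_def by auto
  obtain i k where ik: "j = b i + k" "k < length (sigma ! x i)"
    using ancestor by blast
  have "len n \<le> i"
  proof (rule ccontr)
    assume "\<not> len n \<le> i"
    then have "b (Suc i) \<le> b (len n)"
      by (intro b_mono) simp
    then show False
      using ik j(1) by (simp add: b_len b_Suc)
  qed
  moreover have "i < len (Suc n)"
  proof (rule ccontr)
    assume "\<not> i < len (Suc n)"
    then have "b (len (Suc n)) \<le> b i"
      by (intro b_mono) simp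
    then show False
      using ik j(2) by (simp add: b_len)
  qed
  ultimately have "map x [i..<i + m] \<in> stage m n"
    unfolding stage_def by auto
  then have "map x [i..<i + m] \<in> stage m n'"
    using assms(2) by blast
  then obtain i' where i': "map x [i..<i + m] = map x [i'..<i' + m]" "i' \<in> {len n'..<len (Suc n')}"
    unfolding stage_def by (rule imageE)
  \<comment> \<open>Equal nonempty windows begin with the same letter, so \<open>k\<close> is an
    offset within the block of \<open>x i'\<close> as well.\<close>
  have "x i = x i'"
    using arg_cong[OF i'(1), of hd] assms(1) by (simp add: hd_map)
  then have k: "k < length (sigma ! x i')"
    using ik(2) by simp
  have w: "w = map x [b i' + k..<b i' + k + m]"
    unfolding j(3) ik(1) image_factor[OF assms(1) ik(2)] image_factor[OF assms(1) k] i'(1) ..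
  have "b (len n') \<le> b i'" "b (Suc i') \<le> b (len (Suc n'))"
    using i'(2) by (auto intro: b_mono)
  then show "w \<in> stage m (Suc n')"
    unfolding w stage_def using k by (intro imageI) (simp add: b_len b_Suc)
qed

lemma stage_repeats: "\<exists>n n'. n < n' \<and> stage m n = stage m n'"
proof -
  have "stage m n \<subseteq> {w. set w \<subseteq> A \<and> length w = m}" for n
    unfolding stage_def using set_factor by (intro image_subsetI) simp
  then have "range (stage m) \<subseteq> Pow {w. set w \<subseteq> A \<and> length w = m}"
    by blast
  then have "finite (range (stage m))"
    by (rule finite_subset) (simp add: finite_lists_length_eq)
  then show ?thesis
    by (rule finite_range_repeats)
qed

context
  fixes m n n' :: nat
  assumes m: "m > 0" and nn': "n < n'" and eq: "stage m n = stage m n'"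
begin

text \<open>Each stage determines the next one, so a single repetition makes the sequence of stages
  periodic from \<open>n\<close> on.\<close>

lemma stage_periodic: "n \<le> i \<Longrightarrow> stage m (i + (n' - n) * t) = stage m i"
proof -
  have shift: "stage m (n + k) = stage m (n' + k)" for k
    by (induction k) (simp_all add: eq stage_Suc_mono[OF m] subset_antisym)
  have step: "stage m (i + (n' - n)) = stage m i" if "n \<le> i" for i
    using shift[of "i - n"] that nn' by (simp add: add.commute)
  assume i: "n \<le> i"
  show ?thesis
  proof (induction t)
    case (Suc t)
    then show ?case
      using step[of "i + (n' - n) * t"] i by (simp add: ac_simps del: diff_mult_distrib)
  qed simp
qed

lemma stage_representative: "n \<le> i \<Longrightarrow> \<exists>k. n \<le> k \<and> k < n' \<and> stage m i = stage m k"
proof -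
  assume i: "n \<le> i"
  define k where "k = n + (i - n) mod (n' - n)"
  have "i = k + (n' - n) * ((i - n) div (n' - n))"
    unfolding k_def using i by simp
  then have "stage m i = stage m k"
    using stage_periodic[of k "(i - n) div (n' - n)"] by (simp add: k_def)
  moreover have "k < n'"
    unfolding k_def using mod_less_divisor[of "n' - n" "i - n"] nn' by linarith
  ultimately show ?thesis
    by (intro exI[of _ k]) (simp add: k_def)
qed

lemma position_representative:
  assumes "len n \<le> j"
  shows "\<exists>j'. len n \<le> j' \<and> j' < len n' \<and> map x [j..<j + m] = map x [j'..<j' + m]"
proof -
  have "j < len (n + Suc j)"
    using less_len[of "n + Suc j"] by simp
  then obtain i where i: "n \<le> i" "len i \<le> j" "j < len (Suc i)"
    using step_interval[of n "n + Suc j" len j] assms by auto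
  obtain k where k: "n \<le> k" "k < n'" "stage m i = stage m k"
    using stage_representative[OF i(1)] by blast
  have "map x [j..<j + m] \<in> stage m i"
    unfolding stage_def using i by (intro imageI) simp
  then have "map x [j..<j + m] \<in> stage m k"
    unfolding k(3) .
  then obtain j' where j': "len k \<le> j'" "j' < len (Suc k)" "map x [j..<j + m] = map x [j'..<j' + m]"
    unfolding stage_def by auto
  have "len n \<le> len k" "len (Suc k) \<le> len n'"
    using k by simp_all
  then have "len n \<le> j'" "j' < len n'"
    using j' by linarith+
  then show ?thesis
    using j'(3) by blast
qed

text \<open>The stage of the position returns periodically, and with it the window. This lets a
  property that holds only far out in \<open>x\<close> be read off near the beginning.\<close>

lemma position_recurs:
  assumes "len n \<le> j"
  shows "\<exists>j'\<ge>N. map x [j'..<j' + m] = map x [j..<j + m]"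
proof -
  have "j < len (n + Suc j)"
    using less_len[of "n + Suc j"] by simp
  then obtain i where i: "n \<le> i" "len i \<le> j" "j < len (Suc i)"
    using step_interval[of n "n + Suc j" len j] assms by auto
  have "map x [j..<j + m] \<in> stage m i"
    unfolding stage_def using i by (intro imageI) simp
  then have "map x [j..<j + m] \<in> stage m (i + (n' - n) * N)"
    unfolding stage_periodic[OF i(1)] .
  then obtain j' where j': "len (i + (n' - n) * N) \<le> j'" "map x [j..<j + m] = map x [j'..<j' + m]"
    unfolding stage_def by auto
  have "N \<le> i + (n' - n) * N"
    using nn' by (cases "n' - n") auto
  also have "\<dots> \<le> len (i + (n' - n) * N)"
    using less_len less_imp_le by blast
  finally show ?thesis
    using j' by (intro exI[of _ j']) simp
qed

end

lemma factor_representative: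
  assumes "m > 0" "n < n'" "stage m n = stage m n'"
  shows "\<exists>j'<len n'. map x [j..<j + m] = map x [j'..<j' + m]"
proof (cases "len n \<le> j")
  case True
  then show ?thesis
    using position_representative[OF assms] by blast
next
  case False
  then have "j < len n'"
    using assms(2) len_le_iff[of n n'] by linarith
  then show ?thesis
    by blast
qed

section \<open>Finitely many bounded factors\<close>

text \<open>The first \<open>m\<close> letters of a bounded factor of length at least
  \<open>m\<close> would be a bounded window. Hence bounded factors are proper prefixes of windows,
  and finitely many positions represent all windows.\<close>

lemma bounded_factors_characterization:
  assumes P: "good_exponent sigma P" and m: "m > 0" "n < n'" "stage m n = stage m n'"
    and growing: "\<forall>j<len n'. \<not> bdd (map x [j..<j + m])"
  shows "bounded_factors sigma a1 =
    {u. \<exists>j<len n'. \<exists>k\<le>m. u = take k (map x [j..<j + m]) \<and> \<phi> P (\<phi> P u) = \<phi> P u}"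
    (is "?B = ?R")
proof
  show "?B \<subseteq> ?R"
  proof
    fix u assume "u \<in> ?B"
    then obtain j where u: "u = map x [j..<j + length u]" "bdd u"
      unfolding bounded_factors_def factors_def by blast
    obtain j' where j': "j' < len n'" "map x [j..<j + m] = map x [j'..<j' + m]"
      using factor_representative[OF m] by blast
    have sub: "set u \<subseteq> A"
      using u(1) set_factor[of j "j + length u"] by simp
    have "length u < m"
    proof (rule ccontr)
      assume "\<not> length u < m"
      then have "take m u = map x [j..<j + m]"
        by (subst u(1)) (simp add: take_map take_upt)
      then have "bdd (map x [j'..<j' + m])"
        using bounded_sublist[OF u(2) sub sublist_take, of m] j'(2) by simp
      then show False
        using growing j'(1) by blast
    qed
    then have "u = take (length u) (map x [j'..<j' + m])"
      unfolding j'(2)[symmetric] by (subst u(1)) (simp add: take_map take_upt)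
    then show "u \<in> ?R"
      using j'(1) \<open>length u < m\<close> u(2) good_exponent_bounded[OF P sub] less_imp_le by blast
  qed
  show "?R \<subseteq> ?B"
  proof
    fix u assume "u \<in> ?R"
    then obtain j k where jk: "k \<le> m" "u = take k (map x [j..<j + m])" "\<phi> P (\<phi> P u) = \<phi> P u"
      by blast
    then have "u = map x [j..<j + k]"
      by (simp add: take_map take_upt)
    then show "u \<in> ?B"
      using factorsI set_factor good_exponent_bounded[OF P] jk(3)
      unfolding bounded_factors_def by auto
  qed
qed

lemma finite_bounded_factors_if:
  assumes "good_exponent sigma P" "m > 0" "n < n'" "stage m n = stage m n'"
    and "\<forall>j<len n'. \<not> bdd (map x [j..<j + m])"
  shows "finite (bounded_factors sigma a1)"
proof -
  have "bounded_factors sigma a1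
      \<subseteq> (\<lambda>(j, k). take k (map x [j..<j + m])) ` ({..<len n'} \<times> {..m})"
  proof
    fix u assume "u \<in> bounded_factors sigma a1"
    then obtain j k where "j < len n'" "k \<le> m" "u = take k (map x [j..<j + m])"
      unfolding bounded_factors_characterization[OF assms] by blast
    then show "u \<in> (\<lambda>(j, k). take k (map x [j..<j + m])) ` ({..<len n'} \<times> {..m})"
      by (intro image_eqI[of _ _ "(j, k)"]) simp_all
  qed
  then show ?thesis
    using finite_subset by blast
qed

lemma finite_bounded_factors_obtain:
  assumes "finite (bounded_factors sigma a1)"
  shows "\<exists>m>0. \<forall>j. \<not> bdd (map x [j..<j + m])"
proof (intro exI conjI allI notI)
  \<comment> \<open>One more than the greatest length of a bounded factor.\<close>
  let ?m = "Suc (Max (length ` bounded_factors sigma a1))"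
  show "?m > 0"
    by simp
  fix j assume "bdd (map x [j..<j + ?m])"
  then have "map x [j..<j + ?m] \<in> bounded_factors sigma a1"
    unfolding bounded_factors_def by (intro CollectI conjI factorsI)
  then have "length (map x [j..<j + ?m]) \<le> Max (length ` bounded_factors sigma a1)"
    using assms by (intro Max_ge imageI finite_imageI)
  then show False
    by simp
qed

section \<open>Infinitely many bounded factors\<close>

text \<open>The last clause makes \<open>u\<close> bounded and \<open>\<phi> k u\<close> a fixed
  point for the very exponent \<open>k\<close> of the recurrence, so that equal copies pile up on
  one side of \<open>c\<close>.\<close>

definition power_witness :: "nat \<Rightarrow> nat \<Rightarrow> nat \<Rightarrow> nat list \<Rightarrow> nat list \<Rightarrow> bool" where
  "power_witness s k c u y \<longleftrightarrow> c \<in> set (\<phi> s [a1]) \<and>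
    (\<phi> k [c] = u @ [c] @ y \<or> \<phi> k [c] = y @ [c] @ u) \<and> u \<noteq> [] \<and> \<phi> k (\<phi> k u) = \<phi> k u"

lemma sublist_iter_factor:
  assumes "c \<in> set (\<phi> s [a1])" "sublist w (\<phi> n [c])"
  shows "w \<in> factors x"
proof -
  obtain p q where pq: "\<phi> s [a1] = p @ c # q"
    using split_list[OF assms(1)] by blast
  have "\<phi> (n + s) [a1] = \<phi> n p @ \<phi> n [c] @ \<phi> n q"
    unfolding iter_iter[symmetric] pq by (simp add: iter_Cons[of sigma n c q])
  then show ?thesis
    using assms(2) unfolding factors_x_iff by (metis sublist_appendI sublist_order.order.trans)
qed

lemma iter_replicate_fixed:
  assumes "\<phi> k z = z"
  shows "\<phi> k (concat (replicate n z)) = concat (replicate n z)"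
  by (induction n) (simp_all add: assms)

lemma concat_replicate_Suc: "concat (replicate (Suc n) z) = concat (replicate n z) @ z"
  by (induction n) simp_all

context
  fixes s k c u y z
  assumes witness: "power_witness s k c u y"
    and z: "z = \<phi> k u"
begin

lemma witness_power_pos: "k > 0"
  using witness by (cases k) (auto simp: power_witness_def Cons_eq_append_conv)

lemma power_fixed: "\<phi> k (concat (replicate n z)) = concat (replicate n z)"
  using witness by (intro iter_replicate_fixed) (simp add: power_witness_def z)

lemma power_nonempty: "length z > 0"
proof -
  have c: "set [c] \<subseteq> A"
    using witness set_iter_a1[of s] by (auto simp: power_witness_def)
  have "set u \<subseteq> A"
    using set_iter[OF c, of k] witness by (auto simp: power_witness_def)
  then show ?thesis
    using iter_eq_Nil[of u k] witness by (simp add: power_witness_def z)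
qed

text \<open>Each round of \<open>\<phi> k\<close> emits a new \<open>u\<close> next to
  \<open>c\<close>, turns the previous \<open>u\<close> into a \<open>z\<close> and leaves the older
  copies of \<open>z\<close> fixed. After \<open>Suc n\<close> rounds there are \<open>n\<close> of
  them.\<close>

lemma power_in_bounded_factors: "concat (replicate n z) \<in> bounded_factors sigma a1"
proof -
  have "\<exists>v. \<phi> (k * Suc n) [c] = concat (replicate n z) @ u @ [c] @ v \<or>
    \<phi> (k * Suc n) [c] = v @ [c] @ u @ concat (replicate n z)"
    using witness unfolding power_witness_def
  proof (elim conjE disjE)
    assume c: "\<phi> k [c] = u @ [c] @ y"
    have "\<exists>v. \<phi> (k * Suc n) [c] = concat (replicate n z) @ u @ [c] @ v"
    proof (induction n)
      case (Suc n)
      then obtain v where v: "\<phi> (k * Suc n) [c] = concat (replicate n z) @ u @ [c] @ v"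
        by blast
      have "\<phi> (k * Suc (Suc n)) [c] = \<phi> k (\<phi> (k * Suc n) [c])"
        by (simp add: iter_iter)
      also have "\<dots> = concat (replicate (Suc n) z) @ u @ [c] @ y @ \<phi> k v"
        unfolding v iter_append power_fixed c concat_replicate_Suc by (simp add: z)
      finally show ?case
        by blast
    qed (simp add: c)
    then show ?thesis
      by blast
  next
    assume c: "\<phi> k [c] = y @ [c] @ u"
    have "\<exists>v. \<phi> (k * Suc n) [c] = v @ [c] @ u @ concat (replicate n z)"
    proof (induction n)
      case (Suc n)
      then obtain v where v: "\<phi> (k * Suc n) [c] = v @ [c] @ u @ concat (replicate n z)"
        by blast
      have "\<phi> (k * Suc (Suc n)) [c] = \<phi> k (\<phi> (k * Suc n) [c])"
        by (simp add: iter_iter)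
      also have "\<dots> = (\<phi> k v @ y) @ [c] @ u @ concat (replicate (Suc n) z)"
        unfolding v iter_append power_fixed c by (simp add: z)
      finally show ?case
        by blast
    qed (simp add: c)
    then show ?thesis
      by blast
  qed
  then have "sublist (concat (replicate n z)) (\<phi> (k * Suc n) [c])"
    by (metis append_assoc sublist_append_leftI sublist_append_rightI)
  then have "concat (replicate n z) \<in> factors x"
    using sublist_iter_factor witness unfolding power_witness_def by blast
  moreover have "bdd (concat (replicate n z))"
    by (rule stable_bounded[OF witness_power_pos]) (simp add: power_fixed)
  ultimately show ?thesis
    by (simp add: bounded_factors_def)
qed

lemma infinite_bounded_factors: "infinite (bounded_factors sigma a1)"
proof
  assume fin: "finite (bounded_factors sigma a1)"
  have "range (\<lambda>n. concat (replicate n z)) \<subseteq> bounded_factors sigma a1"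
    using power_in_bounded_factors by blast
  moreover have "inj (\<lambda>n. concat (replicate n z))"
  proof (rule injI)
    fix m n assume "concat (replicate m z) = concat (replicate n z)"
    from arg_cong[OF this, of length] show "m = n"
      using power_nonempty by (simp add: length_concat sum_list_replicate)
  qed
  ultimately show False
    using finite_imageD[OF finite_subset[OF _ fin]] infinite_UNIV_nat by blast
qed

text \<open>Yields the arbitrarily long stretches of period \<open>length z\<close> that
  \<open>ult_periodic_with_period\<close> asks for.\<close>

lemma power_periodic_factor: "\<exists>i. \<forall>j<n. x (i + j + length z) = x (i + j)"
proof -
  \<comment> \<open>One power more than \<open>n\<close>, so that \<open>j\<close> and
    \<open>j + length z\<close> both fall inside the factor.\<close>
  let ?w = "concat (replicate n z)" and ?v = "concat (replicate (Suc n) z)"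
  obtain i where i: "?v = map x [i..<i + length ?v]"
    using power_in_bounded_factors[of "Suc n"] unfolding bounded_factors_def factors_def by blast
  have len: "length ?v = length ?w + length z"
    unfolding concat_replicate_Suc by simp
  have n: "n \<le> length ?w"
    using power_nonempty by (cases "length z") (simp_all add: length_concat sum_list_replicate)
  have "x (i + j + length z) = x (i + j)" if "j < n" for j
  proof -
    have "?v ! (j + length z) = x (i + (j + length z))" "?v ! j = x (i + j)"
      using that n len by (subst i, simp)+
    moreover have "?v ! (j + length z) = ?w ! j"
      by (simp add: nth_append)
    moreover have "?v ! j = ?w ! j"
      unfolding concat_replicate_Suc using that n by (simp add: nth_append)
    ultimately show ?thesis
      by (simp add: add.assoc)
  qed
  then show ?thesis
    by blast
qed

end

end

text \<open>Let \<open>p\<close> be an ultimate period, valid from \<open>N\<close> on. A stretch of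
  length \<open>N + p\<close> meets every residue class modulo \<open>p\<close> beyond
  \<open>N\<close>, where the letter depends on the residue alone; so the period \<open>q\<close> of
  the stretch spreads to all later positions.\<close>

lemma ult_periodic_with_period:
  fixes W :: "nat \<Rightarrow> 'b"
  assumes "ult_periodic W" and long: "\<And>n. \<exists>i. \<forall>j<n. W (i + j + q) = W (i + j)"
  shows "\<exists>N. \<forall>n\<ge>N. W (n + q) = W n"
proof -
  obtain N p where p: "p > 0" "\<And>n. n \<ge> N \<Longrightarrow> W (n + p) = W n"
    using assms(1) unfolding ult_periodic_def by blast
  have per: "W (n + p * t) = W n" if "n \<ge> N" for n t
  proof (induction t)
    case (Suc t)
    then show ?case
      using p(2)[of "n + p * t"] that by (simp add: algebra_simps)
  qed simp
  have cong_le: "W n = W m" if "m \<ge> N" "m \<le> n" "n mod p = m mod p" for m n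
    using that(3,2)
  proof (rule mod_eq_nat1E)
    fix t assume "n = m + p * t"
    then show "W n = W m"
      by (simp only: per[OF that(1)])
  qed
  have cong: "W m = W n" if "m \<ge> N" "n \<ge> N" "m mod p = n mod p" for m n
    using cong_le that by (metis nat_le_linear)
  obtain i where i: "\<And>j. j < N + p \<Longrightarrow> W (i + j + q) = W (i + j)"
    using long[of "N + p"] by blast
  have "W (m + q) = W m" if m: "m \<ge> N" for m
  proof -
    \<comment> \<open>Chosen so that \<open>i + j\<close> is congruent to \<open>m\<close> modulo
      \<open>p\<close>; the added multiple of \<open>p\<close> keeps the subtraction from being
      truncated.\<close>
    define j where "j = N + (m + p * (i + N) - (i + N)) mod p"
    have le: "i + N \<le> m + p * (i + N)"
      using p(1) by (cases p) auto
    have "(i + j) mod p = (i + N + (m + p * (i + N) - (i + N))) mod p"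
      unfolding j_def add.assoc[symmetric] by (rule mod_add_right_eq)
    also have "i + N + (m + p * (i + N) - (i + N)) = m + p * (i + N)"
      using le by (rule le_add_diff_inverse)
    finally have mod: "(i + j) mod p = m mod p"
      by (simp only: mod_mult_self2)
    have "j < N + p"
      unfolding j_def using p(1) by simp
    then have "W (i + j + q) = W (i + j)"
      by (rule i)
    moreover have "i + j \<ge> N"
      by (simp add: j_def)
    then have "W (i + j) = W m" "W (i + j + q) = W (m + q)"
      using m mod mod_add_cong[OF mod refl, of q] by (intro cong; simp)+
    ultimately show ?thesis
      by simp
  qed
  then show ?thesis
    by blast
qed

context prolongable
begin

text \<open>Applying \<open>h\<close> preserves the long stretches of period \<open>q\<close>, so an
  ultimately periodic image has \<open>q\<close> as an ultimate period. Windows of length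
  \<open>q + 1\<close> show both \<open>j\<close> and \<open>j + q\<close>: recurrence brings the
  equality back from far out, and representatives extend the finite test to all later
  positions.\<close>

lemma ult_periodic_image_iff:
  fixes h :: "nat \<Rightarrow> 'b"
  assumes witness: "power_witness s k c u y" and q: "q = length (\<phi> k u)"
    and n: "n < n'" "stage (Suc q) n = stage (Suc q) n'"
  shows "ult_periodic (\<lambda>i. h (x i)) \<longleftrightarrow> (\<forall>j\<in>{len n..<len n'}. h (x j) = h (x (j + q)))"
proof
  have ends: "x j = x j' \<and> x (j + q) = x (j' + q)"
    if "map x [j..<j + Suc q] = map x [j'..<j' + Suc q]" for j j'
    using arg_cong[OF that, of "\<lambda>w. w ! 0"] arg_cong[OF that, of "\<lambda>w. w ! q"]
    by (simp del: upt_Suc)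
  {
    assume "ult_periodic (\<lambda>i. h (x i))"
    moreover have "\<exists>i. \<forall>j<n. h (x (i + j + q)) = h (x (i + j))" for n
      using power_periodic_factor[OF witness refl] q by metis
    ultimately obtain N where N: "\<And>n. n \<ge> N \<Longrightarrow> h (x (n + q)) = h (x n)"
      using ult_periodic_with_period[of "\<lambda>i. h (x i)" q] by blast
    show "\<forall>j\<in>{len n..<len n'}. h (x j) = h (x (j + q))"
    proof
      fix j assume "j \<in> {len n..<len n'}"
      then obtain j' where "j' \<ge> N" "map x [j'..<j' + Suc q] = map x [j..<j + Suc q]"
        using position_recurs[OF zero_less_Suc n, of j N] by auto
      then show "h (x j) = h (x (j + q))"
        using N[of j'] ends by metis
    qed
  }
  assume good: "\<forall>j\<in>{len n..<len n'}. h (x j) = h (x (j + q))"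
  have "h (x (j + q)) = h (x j)" if jn: "j \<ge> len n" for j
  proof -
    obtain j' where j': "len n \<le> j'" "j' < len n'" "map x [j..<j + Suc q] = map x [j'..<j' + Suc q]"
      using position_representative[OF zero_less_Suc n jn] by blast
    have "h (x j') = h (x (j' + q))"
      using good j' by simp
    then show ?thesis
      using ends[OF j'(3)] by simp
  qed
  moreover have "q > 0"
    using power_nonempty[OF witness refl] q by simp
  ultimately show "ult_periodic (\<lambda>i. h (x i))"
    unfolding ult_periodic_def by blast
qed

end

section \<open>Bounded prefixes, suffixes and factors of the iterates of a letter\<close>

context substitution
begin

lemma first_growing:
  assumes "set w \<subseteq> A" "\<not> bdd w"
  shows "\<exists>u d y. w = u @ [d] @ y \<and> bdd u \<and> \<not> bdd [d]"
proof -
  have "\<exists>a\<in>set w. \<not> bdd [a]"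
    using bounded_iff_letters[OF assms(1)] assms(2) by blast
  then obtain u d y where w: "w = u @ d # y" "\<not> bdd [d]" "\<And>a. a \<in> set u \<Longrightarrow> bdd [a]"
    using split_list_first_prop[of w "\<lambda>a. \<not> bdd [a]"] by blast
  then have "bdd u"
    using bounded_iff_letters[of u] assms(1) by auto
  then show ?thesis
    using w by auto
qed

text \<open>The longer of two different bounded prefixes would contain the growing letter that
  follows the shorter one.\<close>

lemma first_growing_unique:
  assumes "set (u @ [d] @ y) \<subseteq> A" "u @ [d] @ y = u' @ [d'] @ y'"
    and "bdd u" "\<not> bdd [d]" "bdd u'" "\<not> bdd [d']"
  shows "u = u' \<and> d = d' \<and> y = y'"
proof -
  have long: "length v \<le> length v'" if "v @ [e] @ z = v' @ [e'] @ z'" "set (v @ [e] @ z) \<subseteq> A"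
    "bdd v" "\<not> bdd [e']" for v v' z z' and e e' :: nat
  proof (rule ccontr)
    assume less: "\<not> length v \<le> length v'"
    have "e' = (v @ [e] @ z) ! length v'"
      unfolding that(1) by simp
    also have "\<dots> = v ! length v'"
      using less by (simp add: nth_append)
    finally have "e' \<in> set v"
      using less by simp
    moreover have "set v \<subseteq> A"
      using that(2) by simp
    ultimately show False
      using bounded_iff_letters that(3,4) by blast
  qed
  have "length u \<le> length u'"
    using long[OF assms(2,1)] assms by blast
  moreover have "length u' \<le> length u"
    using long[OF assms(2)[symmetric] assms(1)[unfolded assms(2)]] assms(4,5) by blast
  ultimately show ?thesis
    using assms(2) by simp
qed

text \<open>The first growing letters of the iterates of \<open>c\<close> take finitely many values, so one of
  them, \<open>d\<close>, recurs: \<open>\<phi> k [d] = u @ [d] @ y\<close> with \<open>u\<close> bounded. If all such \<open>u\<close> are empty, then no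
  bounded prefix is ever added from that moment on.\<close>
lemma bounded_prefixes:
  assumes c: "c < length sigma"
    and no: "\<And>s k d u y. d \<in> set (\<phi> s [c]) \<Longrightarrow> \<phi> k [d] = u @ [d] @ y \<Longrightarrow> bdd u \<Longrightarrow> u = []"
  shows "\<exists>K. \<forall>n u. bdd u \<longrightarrow> prefix u (\<phi> n [c]) \<longrightarrow> length u \<le> K"
proof (cases "bdd [c]")
  case True
  have "set [c] \<subseteq> A"
    using c by simp
  then obtain K where "\<And>n. length (\<phi> n [c]) \<le> K"
    using bounded_iff_length True by blast
  then show ?thesis
    using prefix_length_le order_trans by meson
next
  case growing: False
  have subc: "set [c] \<subseteq> A"
    using c by simp
  have sub: "set (\<phi> n [c]) \<subseteq> A" for n
    by (rule set_iter[OF subc])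
  have "\<not> bdd (\<phi> n [c])" for n
    using growing bounded_iter[OF subc] by simp
  then have "\<exists>u d y. \<phi> n [c] = u @ [d] @ y \<and> bdd u \<and> \<not> bdd [d]" for n
    using first_growing sub by blast
  then obtain U e Y where split: "\<And>n. \<phi> n [c] = U n @ [e n] @ Y n" and U: "\<And>n. bdd (U n)"
    and e: "\<And>n. \<not> bdd [e n]"
    by metis
  have eA: "e n < length sigma" and UA: "set (U n) \<subseteq> A" for n
    using sub[of n] unfolding split by auto
  have "range e \<subseteq> A"
    using eA by auto
  then have "finite (range e)"
    by (rule finite_subset) simp
  then obtain i j where ij: "i < j" "e i = e j"
    using finite_range_repeats by blast
  define d k where "d = e i" and "k = j - i"
  have k: "k > 0"
    using ij(1) by (simp add: k_def)
  have d: "set [d] \<subseteq> A" "\<not> bdd [d]"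
    using eA e by (simp_all add: d_def)
  have dsub: "set (\<phi> n [d]) \<subseteq> A" for n
    by (rule set_iter[OF d(1)])
  have "\<not> bdd (\<phi> k [d])"
    using d bounded_iter by simp
  then obtain u f y where ufy: "\<phi> k [d] = u @ [f] @ y" "bdd u" "\<not> bdd [f]"
    using first_growing dsub by blast
  have "\<phi> j [c] = \<phi> k (\<phi> i [c])"
    using ij(1) by (simp add: iter_iter k_def)
  also have "\<dots> = (\<phi> k (U i) @ u) @ [f] @ y @ \<phi> k (Y i)"
    by (simp only: split[of i] iter_append d_def[symmetric] ufy(1) append_assoc)
  finally have eq: "\<phi> j [c] = (\<phi> k (U i) @ u) @ [f] @ y @ \<phi> k (Y i)" .
  have "set u \<subseteq> A"
    using dsub[of k] ufy(1) by simp
  then have "bdd (\<phi> k (U i) @ u)"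
    using U UA ufy(2) set_iter[OF UA] by (simp add: bounded_append bounded_iter)
  \<comment> \<open>Everything before \<open>f\<close> in \<open>\<phi> j [c]\<close> is bounded, so
    \<open>f\<close> is the first growing letter there, which is \<open>e j\<close>.\<close>
  then have "f = d"
    using first_growing_unique[of "U j" "e j" "Y j" "\<phi> k (U i) @ u" f "y @ \<phi> k (Y i)"]
      sub[of j] eq U e ufy(3) ij(2) unfolding split[of j] d_def by metis
  moreover have "d \<in> set (\<phi> i [c])"
    unfolding split d_def by simp
  ultimately have "u = []"
    using no ufy by metis
  then have dk: "\<phi> k [d] = [d] @ y"
    using ufy(1) \<open>f = d\<close> by simp
  have start: "\<exists>v. \<phi> (k * t) [d] = [d] @ v" for t
  proof (induction t)
    case (Suc t)
    then obtain v where v: "\<phi> (k * t) [d] = [d] @ v"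
      by blast
    have "\<phi> (k * Suc t) [d] = \<phi> k (\<phi> (k * t) [d])"
      by (simp add: iter_iter)
    then show ?case
      unfolding v iter_append dk by simp
  qed simp
  \<comment> \<open>Further iteration carries a nonempty bounded \<open>v\<close> to a bounded
    nonempty prefix of \<open>\<phi> (k * n) [d]\<close>, but that word begins with the growing
    letter \<open>d\<close>.\<close>
  have empty: "v = []" if "bdd v" "prefix v (\<phi> n [d])" for v n
  proof (rule ccontr)
    assume "v \<noteq> []"
    have vA: "set v \<subseteq> A"
      using that(2) dsub[of n] set_mono_prefix by blast
    have "n \<le> k * n"
      using k by (cases k) auto
    then have "\<phi> (k * n) [d] = \<phi> (k * n - n) (\<phi> n [d])"
      by (simp add: iter_iter)
    then have "prefix (\<phi> (k * n - n) v) (\<phi> (k * n) [d])"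
      using that(2) iter_mono_prefix by simp
    moreover have "\<phi> (k * n - n) v \<noteq> []"
      using iter_eq_Nil[OF vA] \<open>v \<noteq> []\<close> by simp
    ultimately have "d \<in> set (\<phi> (k * n - n) v)"
      using start[of n] by (cases "\<phi> (k * n - n) v") auto
    moreover have "bdd (\<phi> (k * n - n) v)"
      using that(1) bounded_iter[OF vA] by simp
    ultimately show False
      using bounded_iff_letters[OF set_iter[OF vA]] d(2) by blast
  qed
  obtain K where K: "\<And>n. length (\<phi> n (U i)) \<le> K"
    using U UA bounded_iff_length by blast
  \<comment> \<open>From \<open>i\<close> on only the descendants of \<open>U i\<close> contribute;
    the earlier iterates are no longer than \<open>\<phi> i [c]\<close>.\<close>
  have "length v \<le> max K (length (\<phi> i [c]))" if v: "bdd v" "prefix v (\<phi> n [c])" for v n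
  proof (cases "i \<le> n")
    case True
    have "\<phi> n [c] = \<phi> (n - i) (\<phi> i [c])"
      using True by (simp add: iter_iter)
    also have "\<dots> = \<phi> (n - i) (U i) @ \<phi> (n - i) [d] @ \<phi> (n - i) (Y i)"
      by (simp only: split[of i] iter_append d_def[symmetric])
    finally have n: "\<phi> n [c] = \<phi> (n - i) (U i) @ \<phi> (n - i) [d] @ \<phi> (n - i) (Y i)" .
    \<comment> \<open>A longer bounded prefix would reach into \<open>\<phi> (n - i) [d]\<close>. It
      cannot cover this growing word, so it would leave a nonempty bounded prefix of it.\<close>
    have "length v \<le> length (\<phi> (n - i) (U i))"
    proof (rule ccontr)
      assume less: "\<not> length v \<le> length (\<phi> (n - i) (U i))"
      then obtain v' where v': "v = \<phi> (n - i) (U i) @ v'"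
        "prefix v' (\<phi> (n - i) [d] @ \<phi> (n - i) (Y i))"
        using v(2) prefix_length_le unfolding n prefix_append by blast
      have vA: "set v \<subseteq> A"
        using v(2) sub[of n] set_mono_prefix by blast
      then have "bdd v'"
        using bounded_sublist[OF v(1) vA] v'(1) by simp
      moreover have "prefix v' (\<phi> (n - i) [d])"
      proof (rule ccontr)
        assume "\<not> prefix v' (\<phi> (n - i) [d])"
        then have "prefix (\<phi> (n - i) [d]) v'"
          using v'(2) unfolding prefix_append by auto
        then have "bdd (\<phi> (n - i) [d])"
          using bounded_sublist[OF \<open>bdd v'\<close>] vA v'(1) by simp
        then show False
          using d bounded_iter by simp
      qed
      ultimately have "v' = []"
        by (rule empty)
      then show False
        using less v'(1) by simp
    qed
    then show ?thesis
      using K[of "n - i"] by simp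
  next
    case False
    then have "length (\<phi> n [c]) \<le> length (\<phi> i [c])"
      using length_iter_mono[OF subc] by simp
    then show ?thesis
      using prefix_length_le[OF v(2)] by simp
  qed
  then show ?thesis
    by blast
qed

text \<open>Reversing the images of all letters exchanges prefixes and suffixes and preserves
  boundedness. Thus the bound for suffixes is the bound for prefixes of the mirrored
  substitution.\<close>

lemma subst_mirror: "set w \<subseteq> A \<Longrightarrow> subst (map rev sigma) (rev w) = rev (subst sigma w)"
  by (induction w) (simp_all add: subst_Cons)

lemma iter_mirror: "set w \<subseteq> A \<Longrightarrow> iter (map rev sigma) n (rev w) = rev (\<phi> n w)"
  by (induction n) (simp_all add: iter_Suc subst_mirror set_iter)

lemma bounded_mirror: "set w \<subseteq> A \<Longrightarrow> bounded_word (map rev sigma) (rev w) \<longleftrightarrow> bdd w"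
  by (simp add: bounded_word_iff iter_mirror)

lemma substitution_mirror: "substitution (map rev sigma)"
  using is_subst non_erasing by unfold_locales (auto simp: is_subst_def non_erasing_def)

lemma bounded_suffixes:
  assumes c: "c < length sigma"
    and no: "\<And>s k d u y. d \<in> set (\<phi> s [c]) \<Longrightarrow> \<phi> k [d] = y @ [d] @ u \<Longrightarrow> bdd u \<Longrightarrow> u = []"
  shows "\<exists>K. \<forall>n u. bdd u \<longrightarrow> suffix u (\<phi> n [c]) \<longrightarrow> length u \<le> K"
proof -
  have mirror: "iter (map rev sigma) n [d] = rev (\<phi> n [d])" if "d < length sigma" for n d
    using iter_mirror[of "[d]" n] that by simp
  have "\<exists>K. \<forall>n u. bounded_word (map rev sigma) u \<longrightarrow> prefix u (iter (map rev sigma) n [c]) \<longrightarrow> length u \<le> K"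
  proof (rule substitution.bounded_prefixes[OF substitution_mirror])
    show "c < length (map rev sigma)"
      using c by simp
    fix s k d u y
    assume *: "d \<in> set (iter (map rev sigma) s [c])" "iter (map rev sigma) k [d] = u @ [d] @ y"
      "bounded_word (map rev sigma) u"
    have d: "d \<in> set (\<phi> s [c])"
      using *(1) by (simp add: mirror[OF c])
    moreover have "set (\<phi> s [c]) \<subseteq> A"
      using c by (intro set_iter) simp
    ultimately have dA: "d < length sigma"
      by auto
    then have k: "\<phi> k [d] = rev y @ [d] @ rev u"
      using arg_cong[OF *(2), of rev] by (simp add: mirror)
    have "set (\<phi> k [d]) \<subseteq> A"
      using dA by (intro set_iter) simp
    then have "bdd (rev u)"
      using *(3) bounded_mirror[of "rev u"] unfolding k by simp
    then show "u = []"
      using no[OF d k] by simp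
  qed
  then obtain K where K: "\<And>n u. bounded_word (map rev sigma) u \<Longrightarrow>
      prefix u (rev (\<phi> n [c])) \<Longrightarrow> length u \<le> K"
    by (auto simp: mirror[OF c])
  have "length u \<le> K" if "bdd u" "suffix u (\<phi> n [c])" for n u
  proof -
    have "set (\<phi> n [c]) \<subseteq> A"
      using c by (intro set_iter) simp
    then have "set u \<subseteq> A"
      using set_mono_suffix[OF that(2)] by blast
    then show ?thesis
      using K[of "rev u" n] that by (simp add: bounded_mirror suffix_to_prefix)
  qed
  then show ?thesis
    by blast
qed

text \<open>A bounded factor that meets the images of several letters consists of a bounded suffix, of
  complete bounded images, and of a bounded prefix.\<close>
lemma bounded_sublist_concat:
  assumes "\<And>d. d \<in> set ds \<Longrightarrow> set (f d) \<subseteq> A"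
    and "\<And>d w. d \<in> set ds \<Longrightarrow> bdd w \<Longrightarrow> sublist w (f d) \<Longrightarrow> length w \<le> C"
    and "\<And>d w. d \<in> set ds \<Longrightarrow> bdd w \<Longrightarrow> prefix w (f d) \<Longrightarrow> length w \<le> K"
    and "\<And>d w. d \<in> set ds \<Longrightarrow> bdd w \<Longrightarrow> suffix w (f d) \<Longrightarrow> length w \<le> K"
  shows "bdd w \<Longrightarrow> prefix w (concat (map f ds)) \<Longrightarrow> length w \<le> length ds * K"
    and "bdd w \<Longrightarrow> sublist w (concat (map f ds)) \<Longrightarrow> length w \<le> max C (length ds * K)"
proof -
  have "(\<forall>w. bdd w \<longrightarrow> prefix w (concat (map f ds)) \<longrightarrow> length w \<le> length ds * K) \<and>
    (\<forall>w. bdd w \<longrightarrow> sublist w (concat (map f ds)) \<longrightarrow> length w \<le> max C (length ds * K))"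
    using assms
  proof (induction ds)
    case (Cons d ds)
    let ?rest = "concat (map f ds)"
    have IH: "(\<forall>w. bdd w \<longrightarrow> prefix w ?rest \<longrightarrow> length w \<le> length ds * K) \<and>
      (\<forall>w. bdd w \<longrightarrow> sublist w ?rest \<longrightarrow> length w \<le> max C (length ds * K))"
    proof (rule Cons.IH)
      fix e assume "e \<in> set ds"
      then have e: "e \<in> set (d # ds)"
        by simp
      show "set (f e) \<subseteq> A"
        by (rule Cons.prems(1)[OF e])
      fix w assume w: "bdd w"
      show "length w \<le> C" if "sublist w (f e)"
        by (rule Cons.prems(2)[OF e w that])
      show "length w \<le> K" if "prefix w (f e)"
        by (rule Cons.prems(3)[OF e w that])
      show "length w \<le> K" if "suffix w (f e)"
        by (rule Cons.prems(4)[OF e w that])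
    qed
    have IH1: "length w \<le> length ds * K" if "bdd w" "prefix w ?rest" for w
      using IH that by blast
    have IH2: "length w \<le> max C (length ds * K)" if "bdd w" "sublist w ?rest" for w
      using IH that by blast
    have A1: "set (f d) \<subseteq> A"
      using Cons.prems(1) by simp
    have "set (f e) \<subseteq> A" if "e \<in> set ds" for e
      using Cons.prems(1) that by simp
    then have A2: "set ?rest \<subseteq> A"
      by auto
    have C: "length w \<le> C" if "bdd w" "sublist w (f d)" for w
      using Cons.prems(2)[OF list.set_intros(1)] that by blast
    have P: "length w \<le> K" if "bdd w" "prefix w (f d)" for w
      using Cons.prems(3)[OF list.set_intros(1)] that by blast
    have S: "length w \<le> K" if "bdd w" "suffix w (f d)" for w
      using Cons.prems(4)[OF list.set_intros(1)] that by blast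
    have 1: "length w \<le> length (d # ds) * K" if w: "bdd w" "prefix w (f d @ ?rest)" for w
      using w(2) unfolding prefix_append
    proof (elim disjE exE conjE)
      assume "prefix w (f d)"
      then show ?thesis
        using P[OF w(1)] by simp
    next
      fix w' assume w': "w = f d @ w'" "prefix w' ?rest"
      then have "set w' \<subseteq> A"
        using A2 set_mono_prefix by blast
      then have "bdd (f d)" "bdd w'"
        using w(1) A1 unfolding w'(1) by (simp_all add: bounded_append)
      \<comment> \<open>A completely covered image is bounded, hence one of its own bounded
        prefixes, and so has length at most \<open>K\<close>.\<close>
      then show ?thesis
        using P[of "f d"] IH1[OF _ w'(2)] w'(1) by simp
    qed
    have 2: "length w \<le> max C (length (d # ds) * K)" if w: "bdd w" "sublist w (f d @ ?rest)" for w
      using w(2) unfolding sublist_append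
    proof (elim disjE exE conjE)
      assume "sublist w (f d)"
      then show ?thesis
        using C[OF w(1)] by simp
    next
      assume "sublist w ?rest"
      then show ?thesis
        using IH2[OF w(1)] by (auto simp: max_def split: if_splits)
    next
      fix s p assume sp: "w = s @ p" "suffix s (f d)" "prefix p ?rest"
      then have "set s \<subseteq> A" "set p \<subseteq> A"
        using A1 A2 set_mono_prefix set_mono_suffix by blast+
      then have "bdd s" "bdd p"
        using w(1) unfolding sp(1) by (simp_all add: bounded_append)
      then show ?thesis
        using S[OF _ sp(2)] IH1[OF _ sp(3)] sp(1) by simp
    qed
    show ?case
      using 1 2 by simp
  qed auto
  then show "bdd w \<Longrightarrow> prefix w (concat (map f ds)) \<Longrightarrow> length w \<le> length ds * K"
    and "bdd w \<Longrightarrow> sublist w (concat (map f ds)) \<Longrightarrow> length w \<le> max C (length ds * K)"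
    by blast+
qed

lemma uniform_letter_bound:
  assumes "\<And>c. c \<in> X \<Longrightarrow> \<exists>K. \<forall>n. Q c n K" "finite X"
    and mono: "\<And>c n K K'. Q c n K \<Longrightarrow> K \<le> K' \<Longrightarrow> Q c n (K' :: nat)"
  shows "\<exists>K. \<forall>c\<in>X. \<forall>n. Q c n K"
proof -
  obtain B where B: "\<And>c n. c \<in> X \<Longrightarrow> Q c n (B c)"
    using assms(1) by metis
  have "Q c n (sum B X)" if "c \<in> X" for c n
    using mono[OF B[OF that]] member_le_sum[OF that _ assms(2), of B] by simp
  then show ?thesis
    by blast
qed

end

section \<open>From infinitely many bounded factors to a power witness\<close>

context prolongable
begin

text \<open>Without such recurrences, bounded prefixes and suffixes of iterated letters are
  uniformly short. The set \<open>X\<close> of letters occurring in \<open>x\<close> is closed under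
  the substitution, so these bounds stay available throughout the induction.\<close>

lemma finite_bounded_factors_no_recurrence:
  assumes no: "\<And>s k d u y. d \<in> set (\<phi> s [a1]) \<Longrightarrow>
    \<phi> k [d] = u @ [d] @ y \<or> \<phi> k [d] = y @ [d] @ u \<Longrightarrow> bdd u \<Longrightarrow> u = []"
  shows "finite (bounded_factors sigma a1)"
proof -
  define X where "X = (\<Union>s. set (\<phi> s [a1]))"
  have X: "X \<subseteq> A"
    using set_iter_a1 by (auto simp: X_def)
  have reach: "d \<in> X" if c: "c \<in> X" and d: "d \<in> set (\<phi> s [c])" for c d s
  proof -
    obtain t where "c \<in> set (\<phi> t [a1])"
      using c by (auto simp: X_def)
    then have "d \<in> set (\<phi> (s + t) [a1])"
      unfolding iter_iter[symmetric] using d iter_concat[of sigma s "\<phi> t [a1]"] by auto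
    then show ?thesis
      unfolding X_def by blast
  qed
  have no': "u = []" if "d \<in> X" "\<phi> k [d] = u @ [d] @ y \<or> \<phi> k [d] = y @ [d] @ u" "bdd u" for d k u y
    using that no unfolding X_def by blast
  have finX: "finite X"
    using X finite_subset by blast
  have "\<exists>K. \<forall>c\<in>X. \<forall>n. \<forall>u. bdd u \<longrightarrow> prefix u (\<phi> n [c]) \<longrightarrow> length u \<le> K"
  proof (rule uniform_letter_bound[OF _ finX])
    fix c assume c: "c \<in> X"
    then show "\<exists>K. \<forall>n. \<forall>u. bdd u \<longrightarrow> prefix u (\<phi> n [c]) \<longrightarrow> length u \<le> K"
      using X reach no' by (intro bounded_prefixes) blast+
  qed (meson order_trans)
  then obtain K1 where K1: "\<And>c n u. c \<in> X \<Longrightarrow> bdd u \<Longrightarrow> prefix u (\<phi> n [c]) \<Longrightarrow> length u \<le> K1"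
    by blast
  have "\<exists>K. \<forall>c\<in>X. \<forall>n. \<forall>u. bdd u \<longrightarrow> suffix u (\<phi> n [c]) \<longrightarrow> length u \<le> K"
  proof (rule uniform_letter_bound[OF _ finX])
    fix c assume c: "c \<in> X"
    then show "\<exists>K. \<forall>n. \<forall>u. bdd u \<longrightarrow> suffix u (\<phi> n [c]) \<longrightarrow> length u \<le> K"
      using X reach no' by (intro bounded_suffixes) blast+
  qed (meson order_trans)
  then obtain K2 where K2: "\<And>c n u. c \<in> X \<Longrightarrow> bdd u \<Longrightarrow> suffix u (\<phi> n [c]) \<Longrightarrow> length u \<le> K2"
    by blast
  define K where "K = max K1 K2"
  define M where "M = (\<Sum>c<length sigma. length (sigma ! c))"
  have M: "length (sigma ! c) \<le> M" if "c \<in> X" for c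
    unfolding M_def using X that by (intro member_le_sum) auto
  \<comment> \<open>A bounded factor of \<open>\<phi> (Suc n) [c]\<close> lies within the
    \<open>n\<close>th iterate of one letter of \<open>sigma ! c\<close>, or it crosses a boundary
    and is controlled by \<open>K\<close> and the number of letters. So the bound does not increase
    with \<open>n\<close>; the constant 1 serves \<open>n = 0\<close>.\<close>
  have bound: "length w \<le> max 1 (M * K)" if "c \<in> X" "bdd w" "sublist w (\<phi> n [c])" for c w n
    using that
  proof (induction n arbitrary: c w)
    case 0
    then show ?case
      using sublist_length_le[OF 0(3)] by simp
  next
    case (Suc n)
    have imX: "d \<in> X" if "d \<in> set (sigma ! c)" for d
      using reach[OF Suc.prems(1), of d 1] that by (simp add: iter_Suc subst_Cons)
    have eq: "\<phi> (Suc n) [c] = concat (map (\<lambda>d. \<phi> n [d]) (sigma ! c))"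
      unfolding iter_Suc' iter_concat[of sigma n "subst sigma [c]"] by (simp add: subst_Cons)
    have "length w \<le> max (max 1 (M * K)) (length (sigma ! c) * K)"
    proof (rule bounded_sublist_concat(2)[where f = "\<lambda>d. \<phi> n [d]"])
      show "bdd w" "sublist w (concat (map (\<lambda>d. \<phi> n [d]) (sigma ! c)))"
        using Suc.prems unfolding eq by simp_all
      fix d assume "d \<in> set (sigma ! c)"
      then have d: "d \<in> X"
        by (rule imX)
      show "set (\<phi> n [d]) \<subseteq> A"
        using X d by (intro set_iter) auto
      fix w assume w: "bdd w"
      show "length w \<le> max 1 (M * K)" if "sublist w (\<phi> n [d])"
        by (rule Suc.IH[OF d w that])
      show "length w \<le> K" if "prefix w (\<phi> n [d])"
        using K1[OF d w that] by (simp add: K_def)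
      show "length w \<le> K" if "suffix w (\<phi> n [d])"
        using K2[OF d w that] by (simp add: K_def)
    qed
    moreover have "length (sigma ! c) * K \<le> M * K"
      using M[OF Suc.prems(1)] by (rule mult_le_mono1)
    ultimately show ?case
      by linarith
  qed
  have a1X: "a1 \<in> X"
    unfolding X_def by (intro UN_I[of 0]) simp_all
  have "bounded_factors sigma a1 \<subseteq> {w. set w \<subseteq> A \<and> length w \<le> max 1 (M * K)}"
  proof
    fix w assume w: "w \<in> bounded_factors sigma a1"
    then obtain n where n: "sublist w (\<phi> n [a1])"
      using factors_x_iff by (auto simp: bounded_factors_def)
    then have "set w \<subseteq> A"
      using set_iter_a1 set_mono_sublist by blast
    then show "w \<in> {w. set w \<subseteq> A \<and> length w \<le> max 1 (M * K)}"
      using bound[OF a1X _ n] w by (simp add: bounded_factors_def)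
  qed
  then show ?thesis
    by (rule finite_subset) (simp add: finite_lists_length_le)
qed

text \<open>Allows \<open>k\<close> to be replaced by a positive multiple, so that the recurrence
  and the stability of the bounded word can share one exponent.\<close>

lemma iterate_recurrence:
  assumes "c < length sigma" "\<phi> k [c] = u @ [c] @ y \<or> \<phi> k [c] = y @ [c] @ u" "u \<noteq> []" "bdd u"
  shows "\<exists>u' y'. (\<phi> (k * Suc t) [c] = u' @ [c] @ y' \<or> \<phi> (k * Suc t) [c] = y' @ [c] @ u') \<and>
    u' \<noteq> [] \<and> bdd u' \<and> set u' \<subseteq> A"
proof -
  have "set (\<phi> k [c]) \<subseteq> A"
    using assms(1) by (intro set_iter) simp
  then have u: "set u \<subseteq> A"
    using assms(2) by auto
  show ?thesis
    using assms(2)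
  proof
    assume c: "\<phi> k [c] = u @ [c] @ y"
    have "\<exists>u' y'. \<phi> (k * Suc t) [c] = u' @ [c] @ y' \<and> u' \<noteq> [] \<and> bdd u' \<and> set u' \<subseteq> A"
    proof (induction t)
      case 0
      then show ?case
        using c u assms(3,4) by auto
    next
      case (Suc t)
      then obtain u' y' where u': "\<phi> (k * Suc t) [c] = u' @ [c] @ y'" "bdd u'" "set u' \<subseteq> A"
        by blast
      have "\<phi> (k * Suc (Suc t)) [c] = \<phi> k (\<phi> (k * Suc t) [c])"
        by (simp add: iter_iter)
      also have "\<dots> = (\<phi> k u' @ u) @ [c] @ (y @ \<phi> k y')"
        unfolding u'(1) iter_append c by simp
      finally show ?case
        using u u' assms(3,4) set_iter[OF u'(3), of k]
        by (intro exI[of _ "\<phi> k u' @ u"] exI[of _ "y @ \<phi> k y'"])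
          (simp add: bounded_append bounded_iter)
    qed
    then show ?thesis
      by blast
  next
    assume c: "\<phi> k [c] = y @ [c] @ u"
    have "\<exists>u' y'. \<phi> (k * Suc t) [c] = y' @ [c] @ u' \<and> u' \<noteq> [] \<and> bdd u' \<and> set u' \<subseteq> A"
    proof (induction t)
      case 0
      then show ?case
        using c u assms(3,4) by auto
    next
      case (Suc t)
      then obtain u' y' where u': "\<phi> (k * Suc t) [c] = y' @ [c] @ u'" "bdd u'" "set u' \<subseteq> A"
        by blast
      have "\<phi> (k * Suc (Suc t)) [c] = \<phi> k (\<phi> (k * Suc t) [c])"
        by (simp add: iter_iter)
      also have "\<dots> = (\<phi> k y' @ y) @ [c] @ (u @ \<phi> k u')"
        unfolding u'(1) iter_append c by simp
      finally show ?case
        using u u' assms(3,4) set_iter[OF u'(3), of k]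
        by (intro exI[of _ "u @ \<phi> k u'"] exI[of _ "\<phi> k y' @ y"])
          (simp add: bounded_append bounded_iter)
    qed
    then show ?thesis
      by blast
  qed
qed

text \<open>The exponent \<open>k * P\<close> is a multiple of \<open>k\<close>, which preserves the
  recurrence, and of the uniform exponent \<open>P\<close>, which stabilises the new bounded
  word.\<close>

lemma power_witness_exists:
  assumes "infinite (bounded_factors sigma a1)"
  shows "\<exists>s k c u y. power_witness s k c u y"
proof -
  have "\<exists>s k c u y. c \<in> set (\<phi> s [a1]) \<and> (\<phi> k [c] = u @ [c] @ y \<or> \<phi> k [c] = y @ [c] @ u) \<and>
    bdd u \<and> u \<noteq> []"
    using finite_bounded_factors_no_recurrence assms by blast
  then obtain s k c u y where c: "c \<in> set (\<phi> s [a1])" "bdd u" "u \<noteq> []"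
    and kc: "\<phi> k [c] = u @ [c] @ y \<or> \<phi> k [c] = y @ [c] @ u"
    by blast
  have k: "k > 0"
    using kc c(3) by (cases k) (auto simp: Cons_eq_append_conv)
  have cA: "c < length sigma"
    using c(1) set_iter_a1 by blast
  obtain P where P: "P > 0" "\<And>w. set w \<subseteq> A \<Longrightarrow> bdd w \<Longrightarrow> \<phi> P (\<phi> P w) = \<phi> P w"
    using uniform_exponent by blast
  obtain t where t: "P = Suc t"
    using P(1) gr0_implies_Suc by blast
  obtain u' y' where u': "u' \<noteq> []" "bdd u'" "set u' \<subseteq> A"
    "\<phi> (k * P) [c] = u' @ [c] @ y' \<or> \<phi> (k * P) [c] = y' @ [c] @ u'"
    using iterate_recurrence[OF cA kc c(3,2), of t] unfolding t by blast
  have "\<phi> (P * k) (\<phi> (P * k) u') = \<phi> (P * k) u'"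
    by (rule iter_stable_mult[OF P(2)[OF u'(3,2)] k])
  then have "power_witness s (k * P) c u' y'"
    unfolding power_witness_def using c(1) u' by (simp add: mult.commute)
  then show ?thesis
    by blast
qed

end

lemma decidable_case_prod [cf_intros]:
  assumes "decidable (\<lambda>p. P (fst p) (fst (snd p)) (snd (snd p)))" "cf g"
  shows "decidable (\<lambda>x. case g x of (a, b) \<Rightarrow> P x a b)"
  using decidable_compose2[of "\<lambda>x q. P x (fst q) (snd q)", OF assms(1) cf_id assms(2)]
  by (simp add: case_prod_beta)

lemma decidable_set_eq [cf_intros]:
  assumes "cf f" "cf l"
  shows "decidable (\<lambda>x. set (f x) = set (l x))"
  unfolding set_eq_subset by (intro cf_intros assms)

section \<open>Certificates\<close>

text \<open>Letters outside the alphabet are erased, because \<open>sigma ! a\<close> is an unspecified value for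
  them.\<close>
definition subst_total :: "nat list list \<Rightarrow> nat list \<Rightarrow> nat list" where
  "subst_total sigma w = concat (map (\<lambda>a. nth_default [] sigma a) w)"

definition iter_total :: "nat list list \<Rightarrow> nat \<Rightarrow> nat list \<Rightarrow> nat list" where
  "iter_total sigma n w = ((\<lambda>v. subst_total sigma v) ^^ n) w"

definition stable :: "nat list list \<Rightarrow> nat \<Rightarrow> nat list \<Rightarrow> bool" where
  "stable sigma P w \<longleftrightarrow> iter_total sigma P (iter_total sigma P w) = iter_total sigma P w"

definition good_exponent_test :: "nat list list \<Rightarrow> nat \<Rightarrow> bool" where
  "good_exponent_test sigma P \<longleftrightarrow> 0 < P \<and>
    (\<forall>a\<in>set [0..<length sigma]. stable sigma P [a] \<or>
      2 \<le> length (iter_total sigma P [a]) \<and>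
      (\<exists>b\<in>set (iter_total sigma P [a]). \<not> stable sigma P [b]))"

definition stage_start :: "nat list list \<Rightarrow> nat \<Rightarrow> nat \<Rightarrow> nat" where
  "stage_start sigma a1 n = length (iter_total sigma n [a1])"

text \<open>Each application of the substitution adds at least one letter to the iterate of
  \<open>a1\<close>, so \<open>n + m\<close> iterations suffice for every window starting before
  \<open>stage_start sigma a1 n\<close> to have full length.\<close>

definition window :: "nat list list \<Rightarrow> nat \<Rightarrow> nat \<Rightarrow> nat \<Rightarrow> nat \<Rightarrow> nat list list" where
  "window sigma a1 m lo n =
    map (\<lambda>j. take m (drop j (iter_total sigma (n + m) [a1]))) [lo..<stage_start sigma a1 n]"

definition same_stage :: "nat list list \<Rightarrow> nat \<Rightarrow> nat \<Rightarrow> nat \<Rightarrow> nat \<Rightarrow> bool" where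
  "same_stage sigma a1 m n n' \<longleftrightarrow> n < n' \<and>
    set (window sigma a1 m (stage_start sigma a1 n) (Suc n)) =
    set (window sigma a1 m (stage_start sigma a1 n') (Suc n'))"

definition finite_certificate ::
  "nat list list \<Rightarrow> nat \<Rightarrow> nat \<Rightarrow> nat \<Rightarrow> nat \<Rightarrow> nat \<Rightarrow> bool" where
  "finite_certificate sigma a1 P m n n' \<longleftrightarrow> good_exponent_test sigma P \<and> 0 < m \<and>
    same_stage sigma a1 m n n' \<and> (\<forall>w\<in>set (window sigma a1 m 0 n'). \<not> stable sigma P w)"

definition infinite_certificate ::
  "nat list list \<Rightarrow> nat \<Rightarrow> nat \<Rightarrow> nat \<Rightarrow> nat \<Rightarrow> nat list \<Rightarrow> nat list \<Rightarrow> nat \<Rightarrow> nat \<Rightarrow> bool" where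
  "infinite_certificate sigma a1 s k c u y n n' \<longleftrightarrow> c \<in> set (iter_total sigma s [a1]) \<and>
    (iter_total sigma k [c] = u @ [c] @ y \<or> iter_total sigma k [c] = y @ [c] @ u) \<and> u \<noteq> [] \<and>
    stable sigma k u \<and> same_stage sigma a1 (Suc (length (iter_total sigma k u))) n n'"

definition bounded_factor_list :: "nat list list \<Rightarrow> nat \<Rightarrow> nat \<Rightarrow> nat \<Rightarrow> nat \<Rightarrow> nat list list" where
  "bounded_factor_list sigma a1 P m n =
    filter (\<lambda>u. stable sigma P u)
      (concat (map (\<lambda>w. map (\<lambda>k. take k w) [0..<Suc m]) (window sigma a1 m 0 n)))"

definition period_test :: "nat list list \<Rightarrow> nat list \<Rightarrow> nat \<Rightarrow> nat \<Rightarrow> nat \<Rightarrow> nat \<Rightarrow> bool" where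
  "period_test sigma hs a1 q n n' \<longleftrightarrow>
    (\<forall>w\<in>set (window sigma a1 (Suc q) (stage_start sigma a1 n) n').
      nth_default 0 hs (nth_default 0 w 0) = nth_default 0 hs (nth_default 0 w q))"

text \<open>For a non-erasing substitution the iterates of the tail of \<open>a1\<close>'s image
  never vanish once the tail is nonempty. This turns \<open>extends_over\<close> into a finite
  check.\<close>

definition valid_input :: "nat list list \<Rightarrow> nat list \<Rightarrow> nat \<Rightarrow> bool" where
  "valid_input sigma hs a1 \<longleftrightarrow>
    (\<forall>w\<in>set sigma. w \<noteq> [] \<and> (\<forall>a\<in>set w. a < length sigma)) \<and> a1 < length sigma \<and>
    2 \<le> length (nth_default [] sigma a1) \<and> take 1 (nth_default [] sigma a1) = [a1] \<and>
    length hs = length sigma"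

section \<open>Computability of the tests\<close>

lemma cf_subst_total [cf_intros]:
  assumes "cf f" "cf g"
  shows "cf (\<lambda>x. subst_total (f x) (g x))"
  unfolding subst_total_def by (intro cf_intros assms[THEN cf_compose])

lemma cf_iter_total [cf_intros]:
  assumes "cf f" "cf n" "cf g"
  shows "cf (\<lambda>x. iter_total (f x) (n x) (g x))"
  unfolding iter_total_def by (intro cf_intros assms[THEN cf_compose])

lemma decidable_stable [cf_intros]:
  assumes "cf f" "cf n" "cf g"
  shows "decidable (\<lambda>x. stable (f x) (n x) (g x))"
  unfolding stable_def by (intro cf_intros assms[THEN cf_compose])

lemma decidable_good_exponent_test [cf_intros]:
  assumes "cf f" "cf n"
  shows "decidable (\<lambda>x. good_exponent_test (f x) (n x))"
  unfolding good_exponent_test_def by (intro cf_intros assms[THEN cf_compose])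

lemma cf_stage_start [cf_intros]:
  assumes "cf f" "cf a" "cf n"
  shows "cf (\<lambda>x. stage_start (f x) (a x) (n x))"
  unfolding stage_start_def by (intro cf_intros assms[THEN cf_compose])

lemma cf_window [cf_intros]:
  assumes "cf f" "cf a" "cf m" "cf l" "cf n"
  shows "cf (\<lambda>x. window (f x) (a x) (m x) (l x) (n x))"
  unfolding window_def by (intro cf_intros assms[THEN cf_compose])

lemma decidable_same_stage [cf_intros]:
  assumes "cf f" "cf a" "cf m" "cf l" "cf n"
  shows "decidable (\<lambda>x. same_stage (f x) (a x) (m x) (l x) (n x))"
  unfolding same_stage_def by (intro cf_intros assms[THEN cf_compose])

lemma decidable_finite_certificate [cf_intros]:
  assumes "cf f" "cf a" "cf P" "cf m" "cf l" "cf n"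
  shows "decidable (\<lambda>x. finite_certificate (f x) (a x) (P x) (m x) (l x) (n x))"
  unfolding finite_certificate_def by (intro cf_intros assms[THEN cf_compose])

lemma decidable_infinite_certificate [cf_intros]:
  assumes "cf f" "cf a" "cf s" "cf k" "cf c" "cf u" "cf y" "cf l" "cf n"
  shows "decidable (\<lambda>x. infinite_certificate (f x) (a x) (s x) (k x) (c x) (u x) (y x) (l x) (n x))"
  unfolding infinite_certificate_def by (intro cf_intros assms[THEN cf_compose])

lemma cf_bounded_factor_list [cf_intros]:
  assumes "cf f" "cf a" "cf P" "cf m" "cf n"
  shows "cf (\<lambda>x. bounded_factor_list (f x) (a x) (P x) (m x) (n x))"
  unfolding bounded_factor_list_def by (intro cf_intros assms[THEN cf_compose])

lemma decidable_period_test [cf_intros]: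
  assumes "cf f" "cf h" "cf a" "cf q" "cf l" "cf n"
  shows "decidable (\<lambda>x. period_test (f x) (h x) (a x) (q x) (l x) (n x))"
  unfolding period_test_def by (intro cf_intros assms[THEN cf_compose])

lemma decidable_valid_input [cf_intros]:
  assumes "cf f" "cf h" "cf a"
  shows "decidable (\<lambda>x. valid_input (f x) (h x) (a x))"
  unfolding valid_input_def by (intro cf_intros assms[THEN cf_compose])

lemma valid_input_iff:
  "valid_input sigma hs a1 \<longleftrightarrow>
    is_subst sigma \<and> non_erasing sigma \<and> extends_over sigma a1 \<and> length hs = length sigma"
proof
  assume v: "valid_input sigma hs a1"
  then have "is_subst sigma" "non_erasing sigma"
    by (auto simp: valid_input_def is_subst_def non_erasing_def)
  then interpret substitution sigma
    by unfold_locales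
  have a1: "a1 < length sigma" "take 1 (sigma ! a1) = [a1]" "2 \<le> length (sigma ! a1)"
    using v by (auto simp: valid_input_def nth_default_def)
  then have "sigma ! a1 = a1 # tl (sigma ! a1) \<and> tl (sigma ! a1) \<noteq> []"
    by (cases "sigma ! a1") auto
  then obtain w where w: "sigma ! a1 = a1 # w" "w \<noteq> []"
    by blast
  have "set w \<subseteq> A"
    using set_subst[of "[a1]"] a1(1) w(1) by (simp add: subst_Cons)
  then have "extends_over sigma a1"
    unfolding extends_over_def iter_def[symmetric] using a1(1) w iter_eq_Nil by blast
  then show "is_subst sigma \<and> non_erasing sigma \<and> extends_over sigma a1 \<and> length hs = length sigma"
    using v is_subst non_erasing by (simp add: valid_input_def)
next
  assume *: "is_subst sigma \<and> non_erasing sigma \<and> extends_over sigma a1 \<and> length hs = length sigma"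
  then obtain w where w: "a1 < length sigma" "sigma ! a1 = a1 # w" "(subst sigma ^^ 0) w \<noteq> []"
    unfolding extends_over_def by blast
  then have "2 \<le> length (sigma ! a1)"
    by (cases w) auto
  then show "valid_input sigma hs a1"
    using * w by (auto simp: valid_input_def is_subst_def non_erasing_def nth_default_def)
qed

section \<open>Correctness of the tests\<close>

context substitution
begin

lemma iter_total_eq [simp]: "set w \<subseteq> A \<Longrightarrow> iter_total sigma n w = \<phi> n w"
proof (induction n)
  case (Suc n)
  have "subst_total sigma v = subst sigma v" if "set v \<subseteq> A" for v
    unfolding subst_total_def subst_def using that
    by (intro arg_cong[of _ _ concat] map_cong refl) (auto simp: nth_default_def)
  then show ?case
    using Suc by (simp add: iter_total_def iter_Suc set_iter)
qed (simp add: iter_total_def)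

lemma stable_iff [simp]: "set w \<subseteq> A \<Longrightarrow> stable sigma P w \<longleftrightarrow> \<phi> P (\<phi> P w) = \<phi> P w"
  by (simp add: stable_def set_iter)

lemma good_exponent_test_iff: "good_exponent_test sigma P \<longleftrightarrow> good_exponent sigma P"
proof -
  have "stable sigma P [b] \<longleftrightarrow> \<phi> P (\<phi> P [b]) = \<phi> P [b]"
    if "a < length sigma" "b \<in> set (\<phi> P [a])" for a b
    using that set_iter[of "[a]" P] by (intro stable_iff) auto
  then show ?thesis
    unfolding good_exponent_test_def good_exponent_def
    by (simp add: atLeast0LessThan cong: bex_cong) (simp add: Ball_def)
qed

end

context prolongable
begin

lemma iter_total_a1 [simp]: "iter_total sigma n [a1] = \<phi> n [a1]"
  using a1_letter by simp

lemma stage_start_eq [simp]: "stage_start sigma a1 n = len n"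
  by (simp add: stage_start_def len_def)

lemma len_add: "len n + m \<le> len (n + m)"
proof (induction m)
  case (Suc m)
  have "len (n + m) < len (n + Suc m)"
    by simp
  then show ?case
    using Suc by linarith
qed simp

lemma window_eq: "window sigma a1 m lo n = map (\<lambda>j. map x [j..<j + m]) [lo..<len n]"
  unfolding window_def stage_start_eq iter_total_a1
proof (intro map_cong refl)
  fix j assume "j \<in> set [lo..<len n]"
  then have "j + m \<le> len (n + m)"
    using len_add[of n m] by simp
  then show "take m (drop j (\<phi> (n + m) [a1])) = map x [j..<j + m]"
    by (rule x_factor[symmetric])
qed

lemma same_stage_iff:
  "same_stage sigma a1 m n n' \<longleftrightarrow> n < n' \<and> stage m n = stage m n'"
  by (simp add: same_stage_def window_eq stage_def)

lemma finite_certificate_iff: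
  "finite_certificate sigma a1 P m n n' \<longleftrightarrow> good_exponent sigma P \<and> m > 0 \<and> n < n' \<and>
    stage m n = stage m n' \<and> (\<forall>j<len n'. \<not> bdd (map x [j..<j + m]))"
proof -
  have "(\<forall>w\<in>set (window sigma a1 m 0 n'). \<not> stable sigma P w) \<longleftrightarrow>
    (\<forall>j<len n'. \<not> bdd (map x [j..<j + m]))" if "good_exponent sigma P"
    using good_exponent_bounded[OF that set_factor] set_factor
    by (simp add: window_eq atLeast0LessThan) (simp add: Ball_def)
  then show ?thesis
    by (auto simp: finite_certificate_def good_exponent_test_iff same_stage_iff)
qed

lemma infinite_certificate_iff:
  "infinite_certificate sigma a1 s k c u y n n' \<longleftrightarrow> power_witness s k c u y \<and> n < n' \<and>
    stage (Suc (length (\<phi> k u))) n = stage (Suc (length (\<phi> k u))) n'"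
proof (cases "c \<in> set (\<phi> s [a1])")
  case True
  then have c: "set [c] \<subseteq> A"
    using set_iter_a1 by auto
  have "set u \<subseteq> A" if "\<phi> k [c] = u @ [c] @ y \<or> \<phi> k [c] = y @ [c] @ u"
    using that set_iter[OF c, of k] by auto
  then show ?thesis
    unfolding infinite_certificate_def power_witness_def iter_total_a1 iter_total_eq[OF c]
    using True same_stage_iff by auto
qed (simp add: infinite_certificate_def power_witness_def)

lemma set_bounded_factor_list:
  assumes "finite_certificate sigma a1 P m n n'"
  shows "set (bounded_factor_list sigma a1 P m n') = bounded_factors sigma a1"
proof -
  have cert: "good_exponent sigma P" "m > 0" "n < n'" "stage m n = stage m n'"
    "\<forall>j<len n'. \<not> bdd (map x [j..<j + m])"
    using assms unfolding finite_certificate_iff by simp_all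
  have st: "stable sigma P (take k (map x [j..<j + m])) \<longleftrightarrow>
    \<phi> P (\<phi> P (take k (map x [j..<j + m]))) = \<phi> P (take k (map x [j..<j + m]))" for j k
    using set_take_subset[of k "map x [j..<j + m]"] set_factor by (intro stable_iff) blast
  have "set (bounded_factor_list sigma a1 P m n') =
    {u. u \<in> (\<Union>j<len n'. (\<lambda>k. take k (map x [j..<j + m])) ` {..m}) \<and> stable sigma P u}"
    unfolding bounded_factor_list_def window_eq
    by (simp add: atLeast0LessThan lessThan_Suc_atMost conj_commute del: upt_Suc)
  also have "\<dots> = {u. \<exists>j<len n'. \<exists>k\<le>m. u = take k (map x [j..<j + m]) \<and> stable sigma P u}"
    by blast
  also have "\<dots> = bounded_factors sigma a1"
    unfolding bounded_factors_characterization[OF cert]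
    by (simp add: st cong: conj_cong del: take_map)
  finally show ?thesis .
qed

lemma period_test_iff:
  assumes "infinite_certificate sigma a1 s k c u y n n'" "length hs = length sigma"
  shows "period_test sigma hs a1 (length (iter_total sigma k u)) n n' \<longleftrightarrow>
    ult_periodic (\<lambda>i. hs ! x i)"
proof -
  have cert: "power_witness s k c u y" "n < n'"
    "stage (Suc (length (\<phi> k u))) n = stage (Suc (length (\<phi> k u))) n'"
    using assms(1) unfolding infinite_certificate_iff by simp_all
  define q where "q = length (\<phi> k u)"
  have c: "set [c] \<subseteq> A"
    using cert(1) set_iter_a1 by (auto simp: power_witness_def)
  have "set u \<subseteq> A"
    using cert(1) set_iter[OF c, of k] by (auto simp: power_witness_def)
  then have q: "length (iter_total sigma k u) = q"
    by (simp add: q_def)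
  \<comment> \<open>The default value is never read: the indices 0 and \<open>q\<close> lie inside a
    window of length \<open>Suc q\<close>, and all letters of \<open>x\<close> lie inside
    \<open>hs\<close>.\<close>
  have "nth_default 0 (map x [j..<j + Suc q]) i = x (j + i)" if "i \<le> q" for i j
    using that by (simp add: nth_default_def del: upt_Suc)
  then have "period_test sigma hs a1 q n n' \<longleftrightarrow> (\<forall>j\<in>{len n..<len n'}. hs ! x j = hs ! x (j + q))"
    unfolding period_test_def window_eq stage_start_eq using x_letter assms(2)
    by (simp add: nth_default_nth del: upt_Suc)
  then show ?thesis
    unfolding q using ult_periodic_image_iff[OF cert(1) q_def cert(2)] cert(3)
    unfolding q_def by blast
qed

end

section \<open>The search for a certificate and the three algorithms\<close>

definition certificate :: "nat list list \<times> nat list \<times> nat \<Rightarrow>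
  nat \<times> (nat \<times> nat \<times> nat \<times> nat) \<times> (nat \<times> nat \<times> nat \<times> nat list \<times> nat list \<times> nat \<times> nat) \<Rightarrow> bool"
  where
  "certificate input z \<longleftrightarrow> (case input of (sigma, hs, a1) \<Rightarrow>
    case z of (b, (P, m, l, n), (s, k, c, u, y, i, j)) \<Rightarrow>
      valid_input sigma hs a1 \<longrightarrow>
        b = 1 \<and> finite_certificate sigma a1 P m l n \<or>
        b = 0 \<and> infinite_certificate sigma a1 s k c u y i j)"

lemma decidable_certificate: "decidable (\<lambda>p. certificate (fst p) (snd p))"
  unfolding certificate_def by (intro cf_intros)

text \<open>Provides the totality that the search requires. On invalid inputs every tuple counts as
  a certificate; on valid ones the half not selected by the tag is filled with dummy values.\<close>

lemma certificate_exists: "\<exists>z. certificate input z"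
proof (cases input)
  case (fields sigma hs a1)
  show ?thesis
  proof (cases "valid_input sigma hs a1")
    case True
    then interpret prolongable sigma a1
      by unfold_locales (simp_all add: valid_input_iff)
    show ?thesis
    proof (cases "finite (bounded_factors sigma a1)")
      case True
      obtain P where P: "good_exponent sigma P"
        using good_exponent_exists by blast
      obtain m where m: "m > 0" "\<forall>j. \<not> bdd (map x [j..<j + m])"
        using finite_bounded_factors_obtain[OF True] by blast
      obtain n n' where "n < n'" "stage m n = stage m n'"
        using stage_repeats by blast
      then have "finite_certificate sigma a1 P m n n'"
        using P m unfolding finite_certificate_iff by blast
      then have "certificate input (1, (P, m, n, n'), (0, 0, 0, [], [], 0, 0))"
        unfolding certificate_def fields by simp
      then show ?thesis
        by blast
    next
      case False
      then obtain s k c u y where w: "power_witness s k c u y"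
        using power_witness_exists by blast
      obtain n n' where "n < n'" "stage (Suc (length (\<phi> k u))) n = stage (Suc (length (\<phi> k u))) n'"
        using stage_repeats by blast
      then have "infinite_certificate sigma a1 s k c u y n n'"
        using w unfolding infinite_certificate_iff by blast
      then have "certificate input (0, (0, 0, 0, 0), (s, k, c, u, y, n, n'))"
        unfolding certificate_def fields by simp
      then show ?thesis
        by blast
    qed
  next
    case False
    then show ?thesis
      unfolding certificate_def fields by auto
  qed
qed

lemma enc_nat_eq: "(enc :: nat \<Rightarrow> nat) = (\<lambda>n. n)"
  by (simp add: fun_eq_iff)

lemma decode_words_enc: "decode_words (enc (ws :: nat list list)) = set ws"
  by (simp add: decode_words_def enc_list_def o_def enc_nat_eq)

lemma encode_input_enc: "encode_input sigma hs a1 = enc (sigma, hs, a1)"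
proof -
  have "(enc :: nat list \<Rightarrow> nat) = list_encode"
    by (simp add: fun_eq_iff enc_list_def enc_nat_eq)
  then show ?thesis
    by (simp add: encode_input_def enc_prod_def enc_list_def[of sigma])
qed

theorem theorem5:
  shows "\<exists>D P L. computable D \<and> computable P \<and> computable L \<and>
    (\<forall>sigma hs a1.
       is_subst sigma \<and> non_erasing sigma \<and> extends_over sigma a1 \<and>
       length hs = length sigma \<longrightarrow>
       (D (encode_input sigma hs a1) \<noteq> 0 \<longleftrightarrow> finite (bounded_factors sigma a1)) \<and>
       (infinite (bounded_factors sigma a1) \<longrightarrow>
          (P (encode_input sigma hs a1) \<noteq> 0 \<longleftrightarrow>
             ult_periodic (\<lambda>i. hs ! fixpt sigma a1 i))) \<and>
       (finite (bounded_factors sigma a1) \<longrightarrow>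
          decode_words (L (encode_input sigma hs a1)) = bounded_factors sigma a1))"
proof -
  \<comment> \<open>A single search serves all three functions, which therefore refer to the same
    certificate.\<close>
  obtain f where f: "cf f" "\<And>input. certificate input (f input)"
    using cf_search[OF decidable_certificate certificate_exists] by blast
  define d where "d input = fst (f input)" for input
  define p where "p input = (case input of (sigma, hs, a1) \<Rightarrow> case f input of
    (b, z, (s, k, c, u, y, i, j)) \<Rightarrow>
      if period_test sigma hs a1 (length (iter_total sigma k u)) i j then 1 else (0 :: nat))" for input
  define l where "l input = (case input of (sigma, hs, a1) \<Rightarrow> case f input of
    (b, (P, m, n, n'), z) \<Rightarrow> bounded_factor_list sigma a1 P m n')" for input
  have cf: "cf d" "cf p" "cf l"
    unfolding d_def p_def l_def by (intro cf_intros f(1)[THEN cf_compose])+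
  show ?thesis
  proof (intro exI conjI allI impI)
    show "computable (\<lambda>n. enc (d (dec n)))" "computable (\<lambda>n. enc (p (dec n)))"
      "computable (\<lambda>n. enc (l (dec n)))"
      using cf unfolding cf_def .
    fix sigma :: "nat list list" and hs :: "nat list" and a1 :: nat
    assume "is_subst sigma \<and> non_erasing sigma \<and> extends_over sigma a1 \<and> length hs = length sigma"
    then have valid: "valid_input sigma hs a1" and hs: "length hs = length sigma"
      by (simp_all add: valid_input_iff)
    interpret prolongable sigma a1
      using valid by unfold_locales (simp_all add: valid_input_iff)
    obtain b P m n n' s k c u y i j where fi: "f (sigma, hs, a1) = (b, (P, m, n, n'), (s, k, c, u, y, i, j))"
      by (metis surj_pair)
    have cert: "b = 1 \<and> finite_certificate sigma a1 P m n n' \<or>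
      b = 0 \<and> infinite_certificate sigma a1 s k c u y i j"
      using f(2)[of "(sigma, hs, a1)"] valid unfolding fi certificate_def by simp
    \<comment> \<open>Soundness of both kinds of certificates: they exclude each other, so the tag
      is right whichever certificate the search returns.\<close>
    have fin: "finite_certificate sigma a1 P m n n' \<Longrightarrow> finite (bounded_factors sigma a1)"
      unfolding finite_certificate_iff using finite_bounded_factors_if by blast
    have inf: "infinite_certificate sigma a1 s k c u y i j \<Longrightarrow> infinite (bounded_factors sigma a1)"
      unfolding infinite_certificate_iff using infinite_bounded_factors by blast
    show "enc (d (dec (encode_input sigma hs a1))) \<noteq> 0 \<longleftrightarrow> finite (bounded_factors sigma a1)"
      using cert fin inf by (auto simp: encode_input_enc d_def fi)
    show "enc (p (dec (encode_input sigma hs a1))) \<noteq> 0 \<longleftrightarrow> ult_periodic (\<lambda>i. hs ! fixpt sigma a1 i)"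
      if "infinite (bounded_factors sigma a1)"
      using cert fin that period_test_iff[OF _ hs, of s k c u y i j]
      by (auto simp: encode_input_enc p_def fi)
    show "decode_words (enc (l (dec (encode_input sigma hs a1)))) = bounded_factors sigma a1"
      if "finite (bounded_factors sigma a1)"
      using cert inf that set_bounded_factor_list[of P m n n']
      by (auto simp: encode_input_enc l_def fi decode_words_enc)
  qed
qed

end
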